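(* Let $0<\alpha<\pi/2$, let $\Delta=\{z\in\mathbb{C}\setminus\{0\}: -\alpha<\arg(z)<\alpha\}$, and let $h\ge 0$. Let $f$ be analytic in $\Delta$ and of exponential type at most $h$ in $\Delta$, i.e. for every $\epsilon>0$ there is a constant $C_\epsilon\ge 0$ such that $|f(z)|\le C_\epsilon e^{(h+\epsilon)|z|}$ for all $z\in\Delta$. Let $I_f$, $\Omega_\theta$, $\Omega$ and the concatenated Laplace transform $g:\Omega\to\mathbb{C}$ be defined as in the context. Then for every $\theta$ with $|\theta|<\alpha$, the function $g$ cannot be analytically continued to any (open) half-plane $\Omega'$ that properly contains the half-plane $\Omega_\theta$, $\Omega_\theta\subsetneq\Omega'$.
   Context: Boundary values: $f$ is bounded near each point of $\partial\Delta$, so by Fatou's theorem it has a non-tangential limit at almost every point of $\partial\Delta$. Extend $f$ to $\bar\Delta$ by letting $f(\zeta)$, $\zeta\in\partial\Delta$, be the non-tangential limit of $f$ at $\zeta$ (from within $\Delta$) if it exists, and $f(\zeta)=0$ otherwise. (The value at the single point $\zeta=0$ is immaterial.) Indicator: for $|\theta|\le\alpha$, $I_f(\theta):=\limsup_{s\to+\infty}\frac{\ln|f(se^{i\theta})|}{s}\in[-\infty,+\infty)$, with $\ln 0=-\infty$. Half-planes: for $|\theta|\le\alpha$, $\Omega_\theta:=\{\omega\in\mathbb{C}:\operatorname{Re}(\omega e^{i\theta})<-I_f(\theta)\}$ (which is all of $\mathbb{C}$ if $I_f(\theta)=-\infty$; in that case no half-plane properly contains it and the assertion is vacuous). Directional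 Laplace transform: for $|\theta|\le\alpha$ and $\omega\in\Omega_\theta$, $$g_\theta(\omega):=\frac{1}{2\pi i}\int_{e^{i\theta}[0,+\infty)}f(\zeta)e^{\omega\zeta}\,d\zeta,$$ the ray being oriented from $0$ to $\infty$. Concatenated Laplace transform: $\Omega:=\bigcup_{|\theta|\le\alpha}\Omega_\theta$, and $g:\Omega\to\mathbb{C}$ is defined by $g(\omega):=g_\theta(\omega)$ for $\omega\in\Omega_\theta$. (This is well-defined: $g_{\theta_1}=g_{\theta_2}$ on $\Omega_{\theta_1}\cap\Omega_{\theta_2}$; moreover $g$ is holomorphic on $\Omega$.) Analytic continuation of $g$ to $\Omega'$ means a holomorphic function on $\Omega'$ that coincides with $g$ on $\Omega\cap\Omega'$. *)

theory Defs
  imports "HOL-Analysis.Analysis"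
begin

definition sector :: "real \<Rightarrow> complex set" where
  "sector \<alpha> = {z. z \<noteq> 0 \<and> - \<alpha> < Arg z \<and> Arg z < \<alpha>}"

definition exp_type_at_most :: "real \<Rightarrow> (complex \<Rightarrow> complex) \<Rightarrow> complex set \<Rightarrow> bool" where
  "exp_type_at_most h f S \<longleftrightarrow>
     (\<forall>\<epsilon>>0. \<exists>C\<ge>0. \<forall>z\<in>S. norm (f z) \<le> C * exp ((h + \<epsilon>) * norm z))"

text \<open>
  The sets below are the usual non-tangential approach regions of aperture \<open>M\<close>. At a boundary point
  where the boundary is locally a straight line they are, near that point, cones with vertex at the
  point; for small \<open>M\<close> they are empty and the corresponding limit condition is vacuous.
\<close>

definition nontangential_region :: "complex set \<Rightarrow> complex \<Rightarrow> real \<Rightarrow> complex set" where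
  "nontangential_region D \<zeta> M = {z \<in> D. dist z \<zeta> < M * infdist z (frontier D)}"

definition has_nontangential_limit ::
  "(complex \<Rightarrow> complex) \<Rightarrow> complex \<Rightarrow> complex set \<Rightarrow> complex \<Rightarrow> bool" where
  "has_nontangential_limit f l D \<zeta> \<longleftrightarrow>
     (\<forall>M. (f \<longlongrightarrow> l) (at \<zeta> within nontangential_region D \<zeta> M))"

text \<open>Only the values on the closure of \<open>D\<close> are meaningful.\<close>

definition boundary_extension :: "complex set \<Rightarrow> (complex \<Rightarrow> complex) \<Rightarrow> complex \<Rightarrow> complex" where
  "boundary_extension D f \<zeta> =
     (if \<zeta> \<in> D then f \<zeta>
      else if \<zeta> \<in> frontier D \<and> (\<exists>l. has_nontangential_limit f l D \<zeta>)
      then (THE l. has_nontangential_limit f l D \<zeta>)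
      else 0)"

text \<open>
  In the following, \<open>f\<close> is a function on \<open>sector \<alpha>\<close>, extended to the two boundary rays
  \<open>\<theta> = \<alpha>\<close> and \<open>\<theta> = - \<alpha>\<close>; the definitions are meant for \<open>\<bar>\<theta>\<bar> \<le> \<alpha>\<close>. The case distinction
  implements the convention that the logarithm of \<open>0\<close> is \<open>-\<infinity>\<close>.
\<close>

definition growth_indicator :: "real \<Rightarrow> (complex \<Rightarrow> complex) \<Rightarrow> real \<Rightarrow> ereal" where
  "growth_indicator \<alpha> f \<theta> =
     Limsup at_top (\<lambda>s::real.
       let w = boundary_extension (sector \<alpha>) f (of_real s * cis \<theta>)
       in if w = 0 then - \<infinity> else ereal (ln (norm w) / s))"

definition laplace_half_plane :: "real \<Rightarrow> (complex \<Rightarrow> complex) \<Rightarrow> real \<Rightarrow> complex set" where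
  "laplace_half_plane \<alpha> f \<theta> = {\<omega>. ereal (Re (\<omega> * cis \<theta>)) < - growth_indicator \<alpha> f \<theta>}"

text \<open>The ray is parametrised by \<open>\<zeta> = s * cis \<theta>\<close>, which gives the factor \<open>cis \<theta>\<close>.\<close>

definition directional_laplace ::
  "real \<Rightarrow> (complex \<Rightarrow> complex) \<Rightarrow> real \<Rightarrow> complex \<Rightarrow> complex" where
  "directional_laplace \<alpha> f \<theta> \<omega> =
     1 / (2 * of_real pi * \<i>) *
     (LINT s:{0..}|lebesgue.
        boundary_extension (sector \<alpha>) f (of_real s * cis \<theta>)
          * exp (\<omega> * (of_real s * cis \<theta>)) * cis \<theta>)"

definition laplace_domain :: "real \<Rightarrow> (complex \<Rightarrow> complex) \<Rightarrow> complex set" where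
  "laplace_domain \<alpha> f = (\<Union>\<theta>\<in>{- \<alpha>..\<alpha>}. laplace_half_plane \<alpha> f \<theta>)"

text \<open>
  For analytic \<open>f\<close> of exponential type, the directional transforms agree wherever two of the
  half-planes overlap, so on \<open>laplace_domain \<alpha> f\<close> the choice of an admissible \<open>\<theta>\<close> is immaterial.
  To have a definite total function, some admissible \<open>\<theta>\<close> is chosen, a boundary direction
  \<open>\<theta> = \<alpha>\<close> or \<open>\<theta> = - \<alpha>\<close> only if no interior one is admissible.
\<close>

definition concat_laplace :: "real \<Rightarrow> (complex \<Rightarrow> complex) \<Rightarrow> complex \<Rightarrow> complex" where
  "concat_laplace \<alpha> f \<omega> =
     (if \<exists>\<theta>. \<bar>\<theta>\<bar> < \<alpha> \<and> \<omega> \<in> laplace_half_plane \<alpha> f \<theta>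
      then directional_laplace \<alpha> f (SOME \<theta>. \<bar>\<theta>\<bar> < \<alpha> \<and> \<omega> \<in> laplace_half_plane \<alpha> f \<theta>) \<omega>
      else directional_laplace \<alpha> f (SOME \<theta>. \<bar>\<theta>\<bar> \<le> \<alpha> \<and> \<omega> \<in> laplace_half_plane \<alpha> f \<theta>) \<omega>)"

definition open_half_plane :: "complex set \<Rightarrow> bool" where
  "open_half_plane H \<longleftrightarrow> (\<exists>u c. u \<noteq> 0 \<and> H = {\<omega>. u \<bullet> \<omega> < c})"

definition analytic_continuation ::
  "(complex \<Rightarrow> complex) \<Rightarrow> complex set \<Rightarrow> (complex \<Rightarrow> complex) \<Rightarrow> complex set \<Rightarrow> bool" where
  "analytic_continuation g D G D' \<longleftrightarrow> G holomorphic_on D' \<and> (\<forall>\<omega>\<in>D \<inter> D'. G \<omega> = g \<omega>)"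

end

theory Submission
  imports Defs "HOL-Complex_Analysis.Complex_Analysis"
begin

text \<open>
  The point is to recover \<open>f\<close> from \<open>g\<close> with a contour that may be pushed into the half-plane of
  continuation. For \<open>z = s cis \<theta>\<close> put
  \<open>A \<phi> p = \<integral> f(\<zeta>) exp(p (\<zeta> - z)) / (\<zeta> - z) d\<zeta>\<close>, integrated along the ray of angle \<open>\<phi>\<close>. On a
  half-plane, \<open>A \<phi>\<close> is a primitive of \<open>2 \<pi> i g(p) exp(- p z)\<close>, and for \<open>p\<close> far to the left Cauchy's formula
  gives \<open>A (\<theta> - \<beta>) p - A (\<theta> + \<beta>) p = 2 \<pi> i f(z)\<close>. A continuation \<open>G\<close> of \<open>g\<close> to
  \<open>Re (p cis \<theta>) < b\<close> yields there a primitive \<open>P\<close> of \<open>G(p) exp(- p z)\<close>, which differs from \<open>A (\<theta> \<plusminus> \<beta>)\<close>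
  (up to the factor \<open>2 \<pi> i\<close>) only by constants. Hence
  \<open>2 \<pi> i f(z) = A (\<theta> - \<beta>) p\<^sub>1 - A (\<theta> + \<beta>) p\<^sub>2 + 2 \<pi> i (P p\<^sub>2 - P p\<^sub>1)\<close> for two points far down and far up
  on a line \<open>Re (p cis \<theta>) = q < b\<close>, and every term on the right is \<open>O(exp(- q s))\<close>. So the indicator at
  \<open>\<theta>\<close> is at most \<open>- q\<close>, which is absurd if \<open>- q\<close> lies below it.
\<close>

section \<open>Integrals over the half-line\<close>

lemma set_integrable_exp_minus_lborel:
  fixes \<epsilon> :: real
  assumes "0 < \<epsilon>"
  shows "set_integrable lborel {0<..} (\<lambda>t. exp (- \<epsilon> * t))"
proof -
  have "(\<lambda>t. exp (- \<epsilon> * t)) absolutely_integrable_on {0..}"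
    by (rule nonnegative_absolutely_integrable_1)
      (use integrable_on_exp_minus_to_infinity[OF assms] in auto)
  then have "(\<lambda>t. exp (- \<epsilon> * t)) absolutely_integrable_on {0<..}"
    by (rule set_integrable_subset) auto
  then show ?thesis
    unfolding set_integrable_def by (subst (asm) integrable_completion) auto
qed

text \<open>The half-line is open because 0 is not in the sector: functions restricted to a ray are
  known to be continuous only for \<open>t > 0\<close>.\<close>

lemma exp_decay_set_integrable:
  fixes u :: "real \<Rightarrow> complex"
  assumes "0 < \<epsilon>" "continuous_on {0<..} u"
    and bound: "\<And>t. 0 < t \<Longrightarrow> norm (u t) \<le> K * exp (- \<epsilon> * t)"
  shows "set_integrable lborel {0<..} u"
    and "norm (LBINT t:{0<..}. u t) \<le> K * (LBINT t:{0<..}. exp (- \<epsilon> * t))"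
proof -
  have int: "set_integrable lborel {0<..} (\<lambda>t. K * exp (- \<epsilon> * t))"
    using set_integrable_exp_minus_lborel[OF assms(1)] by (rule set_integrable_mult_right)
  have meas: "set_borel_measurable borel {0<..} u"
    unfolding set_borel_measurable_def
    by (rule borel_measurable_continuous_on_indicator[OF _ assms(2)]) auto
  show u: "set_integrable lborel {0<..} u"
  proof (rule set_integrable_bound[OF int])
    show "set_borel_measurable lborel {0<..} u"
      using meas by (simp add: set_borel_measurable_def)
    show "AE t in lborel. t \<in> {0<..} \<longrightarrow> norm (u t) \<le> norm (K * exp (- \<epsilon> * t))"
      using bound by (auto intro!: AE_I2 order_trans[OF bound])
  qed
  have "norm (LBINT t:{0<..}. u t) \<le> (LBINT t:{0<..}. norm (u t))"
    by (rule set_integral_norm_bound[OF u])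
  also have "\<dots> \<le> (LBINT t:{0<..}. K * exp (- \<epsilon> * t))"
    by (rule set_integral_mono[OF set_integrable_norm[OF u] int]) (use bound in auto)
  finally show "norm (LBINT t:{0<..}. u t) \<le> K * (LBINT t:{0<..}. exp (- \<epsilon> * t))"
    by simp
qed

text \<open>With \<open>\<epsilon>\<close> half of the gap between \<open>Re w\<close> and
  \<open>- a\<close>, the first integrand decays at rate \<open>2 * \<epsilon>\<close>; in the
  second, one \<open>\<epsilon>\<close> is spent on the extra factor \<open>t\<close>.\<close>

lemma
  fixes u :: "real \<Rightarrow> complex"
  assumes cont: "continuous_on {0<..} u"
    and bound: "\<And>t. 0 < t \<Longrightarrow> norm (u t) \<le> K * exp (a * t)"
    and w: "Re w < - a"
  shows laplace_set_integrable: "set_integrable lborel {0<..} (\<lambda>t. u t * exp (w * of_real t))"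
    and laplace_deriv_set_integrable:
      "set_integrable lborel {0<..} (\<lambda>t. u t * of_real t * exp (w * of_real t))"
proof -
  define \<epsilon> where "\<epsilon> = (- a - Re w) / 2"
  have \<epsilon>: "0 < \<epsilon>" "a + Re w = - 2 * \<epsilon>" using w by (auto simp: \<epsilon>_def)
  have K: "0 \<le> K"
    using order_trans[OF norm_ge_zero bound[of 1]] by (simp add: zero_le_mult_iff)
  have bound': "norm (u t * exp (w * of_real t)) \<le> K * exp (- (2 * \<epsilon>) * t)" if "0 < t" for t
  proof -
    have "norm (u t * exp (w * of_real t)) \<le> (K * exp (a * t)) * exp (Re w * t)"
      using bound[OF that] by (simp add: norm_mult)
    also have "\<dots> = K * exp ((a + Re w) * t)"
      by (simp add: distrib_right exp_add)
    finally show ?thesis by (simp add: \<epsilon>(2))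
  qed
  show "set_integrable lborel {0<..} (\<lambda>t. u t * exp (w * of_real t))"
    using \<epsilon> by (intro exp_decay_set_integrable(1)[OF _ _ bound'] continuous_intros cont) auto
  show "set_integrable lborel {0<..} (\<lambda>t. u t * of_real t * exp (w * of_real t))"
  proof (rule exp_decay_set_integrable(1))
    show "0 < \<epsilon>" by fact
    show "continuous_on {0<..} (\<lambda>t. u t * of_real t * exp (w * of_real t))"
      by (intro continuous_intros cont)
    fix t :: real assume t: "0 < t"
    have lin: "t \<le> 1 / \<epsilon> * exp (\<epsilon> * t)"
    proof -
      have "\<epsilon> * t \<le> exp (\<epsilon> * t)" using exp_ge_add_one_self[of "\<epsilon> * t"] by linarith
      then show ?thesis using \<epsilon>(1) by (simp add: field_simps)
    qed
    have "norm (u t * of_real t * exp (w * of_real t)) = norm (u t * exp (w * of_real t)) * t"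
      using t by (simp add: norm_mult)
    also have "\<dots> \<le> (K * exp (- (2 * \<epsilon>) * t)) * (1 / \<epsilon> * exp (\<epsilon> * t))"
      using t K by (intro mult_mono bound' lin) auto
    also have "\<dots> = K / \<epsilon> * (exp (- (2 * \<epsilon>) * t) * exp (\<epsilon> * t))"
      by simp
    also have "\<dots> = K / \<epsilon> * exp (- \<epsilon> * t)"
      unfolding exp_add[symmetric] by (simp add: algebra_simps)
    finally show "norm (u t * of_real t * exp (w * of_real t)) \<le> K / \<epsilon> * exp (- \<epsilon> * t)" .
  qed
qed

text \<open>Differentiation under the integral by a second-order Taylor estimate for exp. The gap is
  cut into three: one \<open>\<epsilon>\<close> absorbs \<open>exp (norm k * t)\<close>, one absorbs
  \<open>t\<^sup>2\<close>, and the last keeps the remainder integrable.\<close>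

lemma laplace_has_field_derivative:
  fixes u :: "real \<Rightarrow> complex"
  assumes cont: "continuous_on {0<..} u"
    and bound: "\<And>t. 0 < t \<Longrightarrow> norm (u t) \<le> K * exp (a * t)"
    and w: "Re w < - a"
  shows "((\<lambda>w. LBINT t:{0<..}. u t * exp (w * of_real t)) has_field_derivative
      (LBINT t:{0<..}. u t * of_real t * exp (w * of_real t))) (at w)"
proof -
  define \<epsilon> where "\<epsilon> = (- a - Re w) / 3"
  have \<epsilon>: "0 < \<epsilon>" "a + Re w = - 3 * \<epsilon>" using w by (auto simp: \<epsilon>_def)
  have K: "0 \<le> K"
    using order_trans[OF norm_ge_zero bound[of 1]] by (simp add: zero_le_mult_iff)
  have bound': "norm (u t * exp (w * of_real t)) \<le> K * exp (- (3 * \<epsilon>) * t)" if "0 < t" for t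
  proof -
    have "norm (u t * exp (w * of_real t)) \<le> (K * exp (a * t)) * exp (Re w * t)"
      using bound[OF that] by (simp add: norm_mult)
    also have "\<dots> = K * exp ((a + Re w) * t)"
      by (simp add: distrib_right exp_add)
    finally show ?thesis by (simp add: \<epsilon>(2))
  qed
  have exp3: "exp (- (3 * \<epsilon>) * t) * exp (\<epsilon> * t) = exp (- (2 * \<epsilon>) * t)"
    and exp2: "exp (- (2 * \<epsilon>) * t) * exp (\<epsilon> * t) = exp (- \<epsilon> * t)" for t
    unfolding exp_add[symmetric] by (rule arg_cong[of _ _ exp]; simp add: algebra_simps)+
  have sq: "t\<^sup>2 \<le> 2 / \<epsilon>\<^sup>2 * exp (\<epsilon> * t)" if "0 < t" for t
  proof -
    have "1 + \<epsilon> * t + (\<epsilon> * t)\<^sup>2 / 2 \<le> exp (\<epsilon> * t)"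
      by (rule exp_lower_Taylor_quadratic) (use that \<epsilon> in auto)
    moreover have "0 \<le> \<epsilon> * t" using that \<epsilon> by simp
    moreover have "0 \<le> (\<epsilon> * t)\<^sup>2" by simp
    ultimately have "(\<epsilon> * t)\<^sup>2 \<le> 2 * exp (\<epsilon> * t)" by linarith
    with \<epsilon>(1) show "t\<^sup>2 \<le> 2 / \<epsilon>\<^sup>2 * exp (\<epsilon> * t)"
      by (simp add: field_simps)
  qed
  define L where "L = (\<lambda>w. LBINT t:{0<..}. u t * exp (w * of_real t))"
  define L' where "L' = (LBINT t:{0<..}. u t * of_real t * exp (w * of_real t))"
  define I where "I = (LBINT t:{0<..}. exp (- \<epsilon> * t))"
  have int0: "set_integrable lborel {0<..} (\<lambda>t. u t * exp ((w + k) * of_real t))" if "norm k < \<epsilon>" for k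
    using that abs_Re_le_cmod[of k] \<epsilon> by (intro laplace_set_integrable[OF cont bound]) auto
  note int1 = laplace_deriv_set_integrable[OF cont bound w]
  have quad: "norm (L (w + k) - L w - k * L') \<le> (norm k)\<^sup>2 * (2 * K / \<epsilon>\<^sup>2 * I)" if k: "norm k < \<epsilon>" for k
  proof -
    define r where "r = (\<lambda>t. u t * exp ((w + k) * of_real t) - u t * exp (w * of_real t)
      - k * (u t * of_real t * exp (w * of_real t)))"
    have "L (w + k) - L w - k * L' = (LBINT t:{0<..}. r t)"
      unfolding L_def L'_def r_def
      using int0[OF k] int0[of 0] int1 \<epsilon>(1) by (simp add: set_integral_diff)
    moreover have "norm (LBINT t:{0<..}. r t) \<le> (norm k)\<^sup>2 * (2 * K / \<epsilon>\<^sup>2) * I"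
      unfolding I_def
    proof (rule exp_decay_set_integrable(2))
      show "0 < \<epsilon>" by fact
      show "continuous_on {0<..} r"
        unfolding r_def by (intro continuous_intros cont)
      fix t :: real assume t: "0 < t"
      have "r t = u t * exp (w * of_real t) * (exp (k * of_real t) - (\<Sum>i\<le>1. (k * of_real t) ^ i / fact i))"
        by (simp add: r_def algebra_simps exp_add)
      then have "norm (r t) = norm (u t * exp (w * of_real t)) *
          norm (exp (k * of_real t) - (\<Sum>i\<le>1. (k * of_real t) ^ i / fact i))"
        by (simp add: norm_mult)
      also have "\<dots> \<le> (K * exp (- (3 * \<epsilon>) * t)) * (exp (norm (k * of_real t)) * norm (k * of_real t) ^ Suc 1 / fact 1)"
        using t K by (intro mult_mono bound' Taylor_exp_field) auto
      also have "\<dots> = K * (norm k)\<^sup>2 * (exp (- (3 * \<epsilon>) * t) * exp (norm k * t) * t\<^sup>2)"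
        using t by (simp add: norm_mult power2_eq_square)
      also have "\<dots> \<le> K * (norm k)\<^sup>2 * (exp (- (3 * \<epsilon>) * t) * exp (\<epsilon> * t) * (2 / \<epsilon>\<^sup>2 * exp (\<epsilon> * t)))"
        using t K k by (intro mult_left_mono mult_mono sq) auto
      also have "\<dots> = (norm k)\<^sup>2 * (2 * K / \<epsilon>\<^sup>2) * (exp (- (3 * \<epsilon>) * t) * exp (\<epsilon> * t) * exp (\<epsilon> * t))"
        by simp
      also have "\<dots> = (norm k)\<^sup>2 * (2 * K / \<epsilon>\<^sup>2) * exp (- \<epsilon> * t)"
        unfolding exp3 exp2 ..
      finally show "norm (r t) \<le> (norm k)\<^sup>2 * (2 * K / \<epsilon>\<^sup>2) * exp (- \<epsilon> * t)" .
    qed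
    ultimately show ?thesis by (simp add: mult.assoc)
  qed
  have "((\<lambda>k. (L (w + k) - L w) / k - L') \<longlongrightarrow> 0) (at 0)"
  proof (rule Lim_null_comparison)
    show "((\<lambda>k. norm k * (2 * K / \<epsilon>\<^sup>2 * I)) \<longlongrightarrow> 0) (at (0 :: complex))"
      by (intro tendsto_eq_intros) auto
    have "\<forall>\<^sub>F k in at (0 :: complex). k \<in> ball 0 \<epsilon> \<and> k \<noteq> 0"
      using \<epsilon>(1) by (intro eventually_conj eventually_at_in_open' eventually_neq_at_within) auto
    then show "\<forall>\<^sub>F k in at 0. norm ((L (w + k) - L w) / k - L') \<le> norm k * (2 * K / \<epsilon>\<^sup>2 * I)"
    proof eventually_elim
      case (elim k)
      have "(L (w + k) - L w) / k - L' = (L (w + k) - L w - k * L') / k"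
        using elim by (simp add: diff_divide_distrib)
      also have "norm \<dots> \<le> (norm k)\<^sup>2 * (2 * K / \<epsilon>\<^sup>2 * I) / norm k"
        unfolding norm_divide using elim by (intro divide_right_mono quad) auto
      also have "\<dots> = norm k * (2 * K / \<epsilon>\<^sup>2 * I)"
        using elim by (simp add: power2_eq_square)
      finally show ?case .
    qed
  qed
  then show ?thesis
    unfolding DERIV_def by (subst (asm) LIM_zero_iff) (simp add: L_def L'_def)
qed

text \<open>Limits at both ends replace values of \<open>F\<close>, since the primitives used later
  are controlled only on the open sector, which has 0 on its boundary.\<close>

lemma FTC_Ioi:
  fixes F F' :: "real \<Rightarrow> complex"
  assumes "\<And>t. 0 < t \<Longrightarrow> (F has_vector_derivative F' t) (at t)"
    and "continuous_on {0<..} F'" "set_integrable lborel {0<..} F'"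
    and "(F \<longlongrightarrow> A) (at_right 0)" "(F \<longlongrightarrow> B) at_top"
  shows "(LBINT t:{0<..}. F' t) = B - A"
proof -
  have eint: "einterval 0 \<infinity> = {0<..}"
    by (auto simp: einterval_def)
  have "(LBINT t=ereal 0..\<infinity>. F' t) = B - A"
  proof (rule interval_integral_FTC_integrable)
    show "isCont F' t" if "ereal 0 < ereal t" for t
      using assms(2) that by (simp add: continuous_on_eq_continuous_at)
    show "((F \<circ> real_of_ereal) \<longlongrightarrow> A) (at_right (ereal 0))"
      using assms(4) by (simp only: ereal_tendsto_simps1)
    show "((F \<circ> real_of_ereal) \<longlongrightarrow> B) (at_left \<infinity>)"
      using assms(5) by (simp only: ereal_tendsto_simps1)
  qed (use assms eint in \<open>auto simp: zero_ereal_def\<close>)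
  then show ?thesis by (simp add: interval_integral_to_infinity_eq)
qed

section \<open>Sectors and rays\<close>

text \<open>The opening angle is below pi, so the sector is an intersection of two half-planes
  bounded by the lines through its edges. Openness and convexity will be read off from this.\<close>

lemma sector_iff:
  assumes "0 < \<alpha>" "\<alpha> < pi / 2"
  shows "z \<in> sector \<alpha> \<longleftrightarrow> Im (z * cis (- \<alpha>)) < 0 \<and> 0 < Im (z * cis \<alpha>)"
proof (cases "z = 0")
  case False
  define r a where "r = norm z" and "a = Arg z"
  have z: "z = of_real r * cis a" using rcis_cmod_Arg[of z] by (simp add: r_def a_def rcis_def)
  have r: "0 < r" using False by (simp add: r_def)
  have a: "- pi < a" "a \<le> pi" by (simp_all add: a_def mpi_less_Arg Arg_le_pi)
  have "Im (z * cis (- \<alpha>)) = r * sin (a - \<alpha>)" "Im (z * cis \<alpha>) = r * sin (a + \<alpha>)"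
    unfolding z by (simp_all add: mult.assoc cis_mult)
  then have *: "Im (z * cis (- \<alpha>)) < 0 \<longleftrightarrow> sin (a - \<alpha>) < 0" "0 < Im (z * cis \<alpha>) \<longleftrightarrow> 0 < sin (a + \<alpha>)"
    using r by (simp_all add: mult_less_0_iff zero_less_mult_iff)
  have sin_eq: "sin (a - \<alpha>) = - sin (\<alpha> - a)" "sin (- (a + \<alpha>)) = - sin (a + \<alpha>)"
    by (rule sin_minus[of "\<alpha> - a", unfolded minus_diff_eq], rule sin_minus)
  have "sin (a - \<alpha>) < 0 \<and> 0 < sin (a + \<alpha>) \<longleftrightarrow> - \<alpha> < a \<and> a < \<alpha>"
  proof
    assume "- \<alpha> < a \<and> a < \<alpha>"
    then show "sin (a - \<alpha>) < 0 \<and> 0 < sin (a + \<alpha>)"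
      using assms sin_gt_zero[of "\<alpha> - a"] sin_gt_zero[of "a + \<alpha>"] sin_eq by linarith
  next
    assume R: "sin (a - \<alpha>) < 0 \<and> 0 < sin (a + \<alpha>)"
    show "- \<alpha> < a \<and> a < \<alpha>"
    proof (rule ccontr)
      assume "\<not> (- \<alpha> < a \<and> a < \<alpha>)"
      then consider "\<alpha> \<le> a" | "a \<le> - \<alpha>" by linarith
      then show False
      proof cases
        case 1
        then show False using R sin_ge_zero[of "a - \<alpha>"] a assms by linarith
      next
        case 2
        then show False using R sin_ge_zero[of "- (a + \<alpha>)"] a assms sin_eq by linarith
      qed
    qed
  qed
  then show ?thesis using False * by (simp add: sector_def a_def)
qed (simp add: sector_def)

lemma
  assumes "0 < \<alpha>" "\<alpha> < pi / 2"
  shows open_sector: "open (sector \<alpha>)" and convex_sector: "convex (sector \<alpha>)"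
proof -
  have lin: "linear (\<lambda>z. Im (z * w))" for w
    by (intro linearI) (auto simp: algebra_simps)
  have eq: "sector \<alpha> = (\<lambda>z. Im (z * cis (- \<alpha>))) -` {..<0} \<inter> (\<lambda>z. Im (z * cis \<alpha>)) -` {0<..}"
    by (rule set_eqI)
      (simp only: Int_iff vimage_eq lessThan_iff greaterThan_iff sector_iff[OF assms])
  show "open (sector \<alpha>)"
    unfolding eq by (intro open_Int open_vimage continuous_intros)
  show "convex (sector \<alpha>)"
    unfolding eq by (intro convex_Int convex_linear_vimage lin) auto
qed

lemma cis_in_sector:
  assumes "\<bar>\<phi>\<bar> < \<alpha>" "\<alpha> < pi / 2" "0 < t"
  shows "of_real t * cis \<phi> \<in> sector \<alpha>"
  using assms by (auto simp: sector_def Arg_cis Arg_times_of_real2 abs_less_iff)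

lemma polar_in_sector:
  assumes "z \<in> sector \<alpha>"
  obtains t \<phi> where "0 < t" "\<bar>\<phi>\<bar> < \<alpha>" "z = of_real t * cis \<phi>"
proof
  show "0 < norm z" "\<bar>Arg z\<bar> < \<alpha>" using assms by (auto simp: sector_def abs_less_iff)
  show "z = of_real (norm z) * cis (Arg z)" using rcis_cmod_Arg[of z] by (simp add: rcis_def)
qed

text \<open>Along an arc of radius \<open>t\<close> one would bound the increment of the primitive \<open>P\<close> by \<open>t\<close> times the
  maximum of \<open>k\<close>; the chord works equally well because it keeps the distance \<open>t cos \<alpha>\<close> from \<open>0\<close>.\<close>

lemma primitive_chord_bound:
  assumes \<alpha>: "0 < \<alpha>" "\<alpha> < pi / 2"
    and P: "\<And>\<zeta>. \<zeta> \<in> sector \<alpha> \<Longrightarrow> (P has_field_derivative k \<zeta>) (at \<zeta>)"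
    and \<phi>: "\<bar>\<phi>\<^sub>1\<bar> < \<alpha>" "\<bar>\<phi>\<^sub>2\<bar> < \<alpha>" and t: "0 < t"
    and e: "\<And>\<zeta>. \<zeta> \<in> sector \<alpha> \<Longrightarrow> t * cos \<alpha> \<le> norm \<zeta> \<Longrightarrow> norm \<zeta> \<le> t \<Longrightarrow> norm (\<zeta> * k \<zeta>) \<le> e"
  shows "norm (P (of_real t * cis \<phi>\<^sub>1) - P (of_real t * cis \<phi>\<^sub>2)) \<le> 2 * e / cos \<alpha>"
proof -
  let ?a = "of_real t * cis \<phi>\<^sub>1" and ?b = "of_real t * cis \<phi>\<^sub>2"
  let ?S = "closed_segment ?a ?b"
  have c: "0 < cos \<alpha>" using \<alpha> by (intro cos_gt_zero_pi) auto
  have in_sector: "?S \<subseteq> sector \<alpha>"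
    using \<alpha> \<phi> t by (intro closed_segment_subset convex_sector cis_in_sector)
  have lower: "t * cos \<alpha> \<le> norm \<zeta>" and upper: "norm \<zeta> \<le> t" if "\<zeta> \<in> ?S" for \<zeta>
  proof -
    have "t * cos \<alpha> \<le> t * cos \<phi>" if "\<bar>\<phi>\<bar> < \<alpha>" for \<phi>
      using that \<alpha> t cos_monotone_0_pi_le[of "\<bar>\<phi>\<bar>" \<alpha>] by (intro mult_left_mono) auto
    then have "?S \<subseteq> {z. Re z \<ge> t * cos \<alpha>}"
      using \<phi> by (intro closed_segment_subset convex_halfspace_Re_ge) auto
    then show "t * cos \<alpha> \<le> norm \<zeta>"
      using that complex_Re_le_cmod[of \<zeta>] by force
    have "?S \<subseteq> cball 0 t"
      using t by (intro closed_segment_subset convex_cball) (auto simp: norm_mult)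
    then show "norm \<zeta> \<le> t" using that by auto
  qed
  have "norm (P ?a - P ?b) \<le> (e / (t * cos \<alpha>)) * norm (?a - ?b)"
  proof (rule field_differentiable_bound)
    show "convex ?S" by simp
    show "(P has_field_derivative k \<zeta>) (at \<zeta> within ?S)" if "\<zeta> \<in> ?S" for \<zeta>
      using P in_sector that by (blast intro: has_field_derivative_at_within)
    show "norm (k \<zeta>) \<le> e / (t * cos \<alpha>)" if "\<zeta> \<in> ?S" for \<zeta>
    proof -
      have "t * cos \<alpha> * norm (k \<zeta>) \<le> norm \<zeta> * norm (k \<zeta>)"
        using lower[OF that] by (intro mult_right_mono) auto
      also have "\<dots> \<le> e"
        using e[of \<zeta>] lower[OF that] upper[OF that] in_sector that by (auto simp: norm_mult)
      finally show ?thesis using t c by (simp add: field_simps)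
    qed
  qed auto
  also have "\<dots> \<le> (e / (t * cos \<alpha>)) * (2 * t)"
  proof (rule mult_left_mono)
    have "norm (?a - ?b) \<le> norm ?a + norm ?b" by (rule norm_triangle_ineq4)
    then show "norm (?a - ?b) \<le> 2 * t" using t by (simp add: norm_mult)
    have "?a \<in> sector \<alpha>" using \<alpha> \<phi> t by (intro cis_in_sector)
    then have "0 \<le> e"
      using lower[of ?a] upper[of ?a] by (intro order_trans[OF norm_ge_zero e]) auto
    then show "0 \<le> e / (t * cos \<alpha>)" using t c by simp
  qed
  also have "\<dots> = 2 * e / cos \<alpha>" using t by simp
  finally show ?thesis .
qed

text \<open>This replaces the closing arcs when a contour is rotated: where
  \<open>\<zeta> * k \<zeta>\<close> tends to 0, the values of the primitive on two rays at equal
  radius approach each other.\<close>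

lemma primitive_chord_tendsto:
  assumes \<alpha>: "0 < \<alpha>" "\<alpha> < pi / 2"
    and P: "\<And>\<zeta>. \<zeta> \<in> sector \<alpha> \<Longrightarrow> (P has_field_derivative k \<zeta>) (at \<zeta>)"
    and \<phi>: "\<bar>\<phi>\<^sub>1\<bar> < \<alpha>" "\<bar>\<phi>\<^sub>2\<bar> < \<alpha>"
  shows primitive_chord_tendsto_0: "((\<lambda>\<zeta>. \<zeta> * k \<zeta>) \<longlongrightarrow> 0) (at 0 within sector \<alpha>) \<Longrightarrow>
      ((\<lambda>t. P (of_real t * cis \<phi>\<^sub>1) - P (of_real t * cis \<phi>\<^sub>2)) \<longlongrightarrow> 0) (at_right 0)"
    and primitive_chord_tendsto_infinity:
      "((\<lambda>\<zeta>. \<zeta> * k \<zeta>) \<longlongrightarrow> 0) (inf at_infinity (principal (sector \<alpha>))) \<Longrightarrow>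
      ((\<lambda>t. P (of_real t * cis \<phi>\<^sub>1) - P (of_real t * cis \<phi>\<^sub>2)) \<longlongrightarrow> 0) at_top"
proof -
  have c: "0 < cos \<alpha>" using \<alpha> by (intro cos_gt_zero_pi) auto
  let ?D = "\<lambda>t. P (of_real t * cis \<phi>\<^sub>1) - P (of_real t * cis \<phi>\<^sub>2)"
  have bound: "norm (?D t) < e"
    if "0 < t" "0 < e" "\<And>\<zeta>. \<zeta> \<in> sector \<alpha> \<Longrightarrow> t * cos \<alpha> \<le> norm \<zeta> \<Longrightarrow> norm \<zeta> \<le> t \<Longrightarrow>
      norm (\<zeta> * k \<zeta>) < e * cos \<alpha> / 4" for t e
  proof -
    \<comment> \<open>The divisor 4 leaves \<open>e / 2\<close>, hence a strict bound.\<close>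
    have "norm (?D t) \<le> 2 * (e * cos \<alpha> / 4) / cos \<alpha>"
      using that by (intro primitive_chord_bound[OF \<alpha> P \<phi>]) (auto intro: less_imp_le)
    also have "\<dots> < e" using c that by simp
    finally show ?thesis .
  qed
  show "(?D \<longlongrightarrow> 0) (at_right 0)" if "((\<lambda>\<zeta>. \<zeta> * k \<zeta>) \<longlongrightarrow> 0) (at 0 within sector \<alpha>)"
  proof (rule tendstoI)
    fix e :: real assume e: "0 < e"
    then have "\<forall>\<^sub>F \<zeta> in at 0 within sector \<alpha>. dist (\<zeta> * k \<zeta>) 0 < e * cos \<alpha> / 4"
      using c by (intro tendstoD[OF that]) auto
    then obtain d where d: "0 < d" "\<And>\<zeta>. \<zeta> \<in> sector \<alpha> \<Longrightarrow> \<zeta> \<noteq> 0 \<Longrightarrow> norm \<zeta> < d \<Longrightarrow> norm (\<zeta> * k \<zeta>) < e * cos \<alpha> / 4"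
      unfolding eventually_at by auto
    have "\<forall>\<^sub>F t in at_right 0. 0 < t \<and> t < d"
      using d(1) unfolding eventually_at_right_field by blast
    then show "\<forall>\<^sub>F t in at_right 0. dist (?D t) 0 < e"
    proof eventually_elim
      case (elim t)
      then have "norm (?D t) < e"
        using e by (intro bound d(2)) (auto simp: sector_def)
      then show ?case by simp
    qed
  qed
  show "(?D \<longlongrightarrow> 0) at_top" if "((\<lambda>\<zeta>. \<zeta> * k \<zeta>) \<longlongrightarrow> 0) (inf at_infinity (principal (sector \<alpha>)))"
  proof (rule tendstoI)
    fix e :: real assume e: "0 < e"
    then have "\<forall>\<^sub>F \<zeta> in inf at_infinity (principal (sector \<alpha>)). dist (\<zeta> * k \<zeta>) 0 < e * cos \<alpha> / 4"
      using c by (intro tendstoD[OF that]) auto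
    then obtain b where b: "\<And>\<zeta>. \<zeta> \<in> sector \<alpha> \<Longrightarrow> b \<le> norm \<zeta> \<Longrightarrow> norm (\<zeta> * k \<zeta>) < e * cos \<alpha> / 4"
      unfolding eventually_inf_principal eventually_at_infinity by auto
    \<comment> \<open>Points of the chord have norm at least \<open>t * cos \<alpha>\<close>, so
      \<open>t\<close> beyond \<open>b / cos \<alpha>\<close> puts the whole chord where the
      estimate holds; the 1 keeps \<open>t\<close> positive.\<close>
    have "\<forall>\<^sub>F t in at_top. max 1 (b / cos \<alpha>) \<le> t"
      by (rule eventually_ge_at_top)
    then show "\<forall>\<^sub>F t in at_top. dist (?D t) 0 < e"
    proof eventually_elim
      case (elim t)
      then have "b \<le> t * cos \<alpha>" using c by (simp add: field_simps)
      then have "norm (?D t) < e"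
        using e elim by (intro bound b) auto
      then show ?case by simp
    qed
  qed
qed

lemma has_vector_derivative_along_ray:
  assumes "(P has_field_derivative k) (at (of_real t * cis \<phi>))"
  shows "((\<lambda>t. P (of_real t * cis \<phi>)) has_vector_derivative k * cis \<phi>) (at t)"
proof -
  have "((\<lambda>t. of_real t * cis \<phi>) has_vector_derivative cis \<phi>) (at t)"
    by (simp add: scaleR_conv_of_real[symmetric]) (auto intro!: derivative_eq_intros)
  from field_vector_diff_chain_at[OF this assms] show ?thesis
    by (simp add: o_def mult.commute)
qed

section \<open>Distances and logarithms along rays\<close>

text \<open>For \<open>s \<ge> 0\<close> the bound is the distance of \<open>s cis \<theta>\<close>
  from the line through the other ray; rotation by \<open>- \<phi>\<close> makes that line the real
  axis. It keeps contours away from the pole.\<close>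

lemma norm_diff_rays_ge: "s * \<bar>sin (\<phi> - \<theta>)\<bar> \<le> norm (of_real t * cis \<phi> - of_real s * cis \<theta>)"
proof -
  have "(of_real t * cis \<phi> - of_real s * cis \<theta>) * cis (- \<phi>) = of_real t - of_real s * cis (\<theta> - \<phi>)"
    by (simp add: left_diff_distrib mult.assoc cis_mult)
  then have "Im ((of_real t * cis \<phi> - of_real s * cis \<theta>) * cis (- \<phi>)) = s * sin (\<phi> - \<theta>)"
    using sin_minus[of "\<phi> - \<theta>"] by simp
  then have "\<bar>s * sin (\<phi> - \<theta>)\<bar> \<le> norm ((of_real t * cis \<phi> - of_real s * cis \<theta>) * cis (- \<phi>))"
    by (metis abs_Im_le_cmod)
  moreover have "s * \<bar>sin (\<phi> - \<theta>)\<bar> \<le> \<bar>s * sin (\<phi> - \<theta>)\<bar>"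
    by (simp add: abs_mult mult_right_mono)
  ultimately show ?thesis by (simp add: norm_mult)
qed

lemma Re_pos_in_sector:
  assumes "0 < \<alpha>" "\<alpha> < pi / 2" "\<zeta> \<in> sector \<alpha>"
  shows "norm \<zeta> * cos \<alpha> \<le> Re \<zeta>" and "0 < Re \<zeta>"
proof -
  obtain t \<phi> where t: "0 < t" "\<bar>\<phi>\<bar> < \<alpha>" and \<zeta>: "\<zeta> = of_real t * cis \<phi>"
    using polar_in_sector[OF assms(3)] .
  have "cos \<alpha> \<le> cos \<bar>\<phi>\<bar>"
    using t assms(1,2) by (intro cos_monotone_0_pi_le) auto
  then show *: "norm \<zeta> * cos \<alpha> \<le> Re \<zeta>"
    using t by (simp add: \<zeta> norm_mult)
  have "0 < cos \<alpha>" using assms(1,2) by (intro cos_gt_zero_pi) auto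
  then have "0 < norm \<zeta> * cos \<alpha>" using t by (simp add: \<zeta> norm_mult)
  with * show "0 < Re \<zeta>" by linarith
qed

text \<open>The numerator is twice the cross product of \<open>z\<close> and \<open>\<zeta>\<close>,
  so its sign tells on which side of the line through 0 and \<open>z\<close> the point
  \<open>\<zeta>\<close> lies.\<close>

lemma Re_cayley:
  assumes "z + \<zeta> \<noteq> 0"
  shows "Re (\<i> * (z - \<zeta>) / (z + \<zeta>)) = 2 * (Im \<zeta> * Re z - Re \<zeta> * Im z) / (norm (z + \<zeta>))\<^sup>2"
  by (simp add: Re_divide cmod_power2 algebra_simps)

text \<open>The logarithm of the Cayley-type transform is a primitive of \<open>1/(\<zeta> - z) - 1/(\<zeta> + z)\<close>; the factor
  \<open>c = \<plusminus>\<i>\<close> rotates the half-plane in which the transform takes its values on the ray into the right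
  half-plane, so that the principal branch can be used at both ends of the ray.\<close>

lemma log_along_ray:
  assumes z: "z = of_real s * cis \<theta>" "0 < s"
    and \<phi>: "0 < t \<Longrightarrow> of_real t * cis \<phi> + z \<noteq> 0"
    and c: "c = \<i> \<and> 0 < sin (\<phi> - \<theta>) \<or> c = - \<i> \<and> sin (\<phi> - \<theta>) < 0"
  defines "L \<equiv> \<lambda>t. Ln (c * (z - of_real t * cis \<phi>) / (z + of_real t * cis \<phi>))"
  shows "0 < t \<Longrightarrow> (L has_vector_derivative
      (1 / (of_real t * cis \<phi> - z) - 1 / (of_real t * cis \<phi> + z)) * cis \<phi>) (at t)"
    and "(L \<longlongrightarrow> Ln c) (at_right 0)" and "(L \<longlongrightarrow> Ln (- c)) at_top"
proof -
  have z0: "z \<noteq> 0" using z by simp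
  have c0: "c \<notin> \<real>\<^sub>\<le>\<^sub>0" "- c \<notin> \<real>\<^sub>\<le>\<^sub>0" "c \<noteq> 0" using c by (auto simp: complex_nonpos_Reals_iff)
  show "(L has_vector_derivative
      (1 / (of_real t * cis \<phi> - z) - 1 / (of_real t * cis \<phi> + z)) * cis \<phi>) (at t)" if t: "0 < t"
    unfolding L_def
  proof (rule has_vector_derivative_along_ray[of "\<lambda>\<zeta>. Ln (c * (z - \<zeta>) / (z + \<zeta>))"])
    define \<zeta> where "\<zeta> = of_real t * cis \<phi>"
    have plus: "z + \<zeta> \<noteq> 0" using \<phi>[OF t] by (simp add: \<zeta>_def add.commute)
    have "Im \<zeta> * Re z - Re \<zeta> * Im z = t * s * sin (\<phi> - \<theta>)"
      by (simp add: \<zeta>_def z sin_diff algebra_simps)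
    then have "Re (\<i> * (z - \<zeta>) / (z + \<zeta>)) = 2 * (t * s * sin (\<phi> - \<theta>)) / (norm (z + \<zeta>))\<^sup>2"
      by (simp add: Re_cayley[OF plus])
    moreover have "Re (- \<i> * (z - \<zeta>) / (z + \<zeta>)) = - Re (\<i> * (z - \<zeta>) / (z + \<zeta>))"
      by simp
    \<comment> \<open>The sign of \<open>c\<close> is coupled to that of
      \<open>sin (\<phi> - \<theta>)\<close>, which makes the real part positive in both
      cases.\<close>
    ultimately have pos: "0 < Re (c * (z - \<zeta>) / (z + \<zeta>))"
      using c t z(2) plus by (auto simp: zero_less_divide_iff divide_less_0_iff mult_pos_neg)
    then have arg: "c * (z - \<zeta>) / (z + \<zeta>) \<notin> \<real>\<^sub>\<le>\<^sub>0"
      by (auto simp: complex_nonpos_Reals_iff)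
    have minus: "z - \<zeta> \<noteq> 0" using pos by auto
    have "((\<lambda>\<zeta>. Ln (c * (z - \<zeta>) / (z + \<zeta>))) has_field_derivative
        inverse (c * (z - \<zeta>) / (z + \<zeta>)) * ((- c * (z + \<zeta>) - c * (z - \<zeta>)) / ((z + \<zeta>) * (z + \<zeta>)))) (at \<zeta>)"
      using plus arg by (auto intro!: derivative_eq_intros)
    also have "inverse (c * (z - \<zeta>) / (z + \<zeta>)) * ((- c * (z + \<zeta>) - c * (z - \<zeta>)) / ((z + \<zeta>) * (z + \<zeta>)))
        = 1 / (\<zeta> - z) - 1 / (\<zeta> + z)"
      using plus minus c0 by (simp add: divide_simps) algebra
    finally show "((\<lambda>\<zeta>. Ln (c * (z - \<zeta>) / (z + \<zeta>))) has_field_derivative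
        1 / (of_real t * cis \<phi> - z) - 1 / (of_real t * cis \<phi> + z)) (at (of_real t * cis \<phi>))"
      by (simp add: \<zeta>_def)
  qed
  have "((\<lambda>t. c * (z - of_real t * cis \<phi>) / (z + of_real t * cis \<phi>)) \<longlongrightarrow>
      c * (z - of_real 0 * cis \<phi>) / (z + of_real 0 * cis \<phi>)) (at_right 0)"
    by (intro tendsto_intros) (use z0 in simp)
  then show "(L \<longlongrightarrow> Ln c) (at_right 0)"
    unfolding L_def using z0 c0 by (intro tendsto_Ln) auto
  have lim: "filterlim (\<lambda>t. z + of_real t * cis \<phi>) at_infinity at_top"
  proof (rule tendsto_add_filterlim_at_infinity[OF tendsto_const])
    show "filterlim (\<lambda>t. of_real t * cis \<phi>) at_infinity at_top"
      unfolding filterlim_at_infinity_conv_norm_at_top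
      by (simp add: norm_mult filterlim_abs_real)
  qed
  \<comment> \<open>Writing the quotient as \<open>c * (2 * z / (z + \<zeta>) - 1)\<close> makes its
    limit \<open>- c\<close> visible.\<close>
  have "((\<lambda>t. c * (2 * z * inverse (z + of_real t * cis \<phi>) - 1)) \<longlongrightarrow> c * (2 * z * 0 - 1)) at_top"
    by (intro tendsto_intros filterlim_compose[OF tendsto_inverse_0 lim])
  moreover have "\<forall>\<^sub>F t in at_top. c * (2 * z * inverse (z + of_real t * cis \<phi>) - 1)
      = c * (z - of_real t * cis \<phi>) / (z + of_real t * cis \<phi>)"
  proof -
    have "\<forall>\<^sub>F t in at_top. z + of_real t * cis \<phi> \<noteq> 0"
      using lim by (rule filterlim_at_infinity_imp_eventually_ne)
    then show ?thesis by eventually_elim (simp add: field_simps)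
  qed
  ultimately have "((\<lambda>t. c * (z - of_real t * cis \<phi>) / (z + of_real t * cis \<phi>)) \<longlongrightarrow> - c) at_top"
    by (subst (asm) tendsto_cong) auto
  then show "(L \<longlongrightarrow> Ln (- c)) at_top"
    unfolding L_def using c0 by (intro tendsto_Ln)
qed

section \<open>Half-planes and the indicator\<close>

lemma open_convex_rotated_half_plane:
  fixes v :: complex
  shows "open {p. Re (p * v) < b}" and "convex {p. Re (p * v) < b}"
proof -
  have eq: "{p. Re (p * v) < b} = (\<lambda>p. Re (p * v)) -` {..<b}" by auto
  show "open {p. Re (p * v) < b}"
    unfolding eq by (intro open_vimage continuous_intros)
  have "linear (\<lambda>p. Re (p * v))" by (intro linearI) (auto simp: algebra_simps)
  then show "convex {p. Re (p * v) < b}"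
    unfolding eq by (intro convex_linear_vimage) auto
qed

text \<open>Nested half-planes have parallel boundary lines. In the rotated coordinate
  \<open>\<omega> * cis \<theta>\<close> the outer normal becomes \<open>(x, y)\<close>; inclusion
  forces \<open>y = 0\<close> and \<open>x > 0\<close>, and properness then gives room beyond
  \<open>b\<close>.\<close>

lemma half_plane_psubset:
  assumes u: "u \<noteq> (0 :: complex)"
    and sub: "{\<omega>. Re (\<omega> * cis \<theta>) < b} \<subset> {\<omega>. u \<bullet> \<omega> < c}"
  obtains b' where "b < b'" "{\<omega>. Re (\<omega> * cis \<theta>) < b'} \<subseteq> {\<omega>. u \<bullet> \<omega> < c}"
proof -
  define x y where "x = Re (u * cis \<theta>)" and "y = Im (u * cis \<theta>)"
  \<comment> \<open>The inner product is invariant under rotating both factors by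
    \<open>\<theta>\<close>.\<close>
  have inner: "u \<bullet> \<omega> = x * Re (\<omega> * cis \<theta>) + y * Im (\<omega> * cis \<theta>)" for \<omega>
  proof -
    have "(cos \<theta>)\<^sup>2 + (sin \<theta>)\<^sup>2 = 1" by simp
    then show ?thesis
      unfolding x_def y_def inner_complex_def times_complex.sel cis.sel by algebra
  qed
  have in_sub: "x * r + y * t < c" if "r < b" for r t
  proof -
    define \<omega> where "\<omega> = Complex r t * cis (- \<theta>)"
    have "\<omega> * cis \<theta> = Complex r t" by (simp add: \<omega>_def mult.assoc cis_mult)
    then have "Re (\<omega> * cis \<theta>) = r" "Im (\<omega> * cis \<theta>) = t" by (simp_all only: complex.sel)
    moreover from this(1) have "u \<bullet> \<omega> < c" using sub that by blast
    ultimately show ?thesis by (simp only: inner)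
  qed
  have y: "y = 0"
  proof (rule ccontr)
    assume "y \<noteq> 0"
    \<comment> \<open>This value of \<open>t\<close> gives a point exactly on the boundary line of
      the outer half-plane.\<close>
    then show False
      using in_sub[of "b - 1" "(c - x * (b - 1)) / y"] by simp
  qed
  have "x \<noteq> 0"
  proof
    assume "x = 0"
    then have "u * cis \<theta> = 0" using y by (simp add: x_def y_def complex_eq_iff)
    then show False using u by simp
  qed
  moreover have "\<not> x < 0"
  proof
    assume x: "x < 0"
    have "x * min (b - 1) (c / x) < c" using in_sub[of "min (b - 1) (c / x)" 0] by simp
    moreover have "c \<le> x * min (b - 1) (c / x)"
      using x mult_left_mono_neg[of "min (b - 1) (c / x)" "c / x" x] by simp
    ultimately show False by simp
  qed
  ultimately have x: "0 < x" by simp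
  obtain \<omega> where "u \<bullet> \<omega> < c" "b \<le> Re (\<omega> * cis \<theta>)" using sub by force
  then have "Re (\<omega> * cis \<theta>) < c / x"
    using x unfolding inner y by (simp only: pos_less_divide_eq mult.commute mult_zero_left add_0_right)
  with \<open>b \<le> Re (\<omega> * cis \<theta>)\<close> have "b < c / x" by (rule le_less_trans)
  moreover have "{\<omega>. Re (\<omega> * cis \<theta>) < c / x} \<subseteq> {\<omega>. u \<bullet> \<omega> < c}"
    using x y by (auto simp: inner field_simps)
  ultimately show thesis by (rule that)
qed

text \<open>The constant factor contributes only \<open>ln M / s\<close>, which vanishes in the
  limit. Applied once with the crude exponential rate and once with the decay that a continuation
  would force.\<close>

lemma growth_indicator_le:
  assumes "\<bar>\<theta>\<bar> < \<alpha>" "\<alpha> < pi / 2" "0 < M"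
    and bound: "\<And>s. 1 \<le> s \<Longrightarrow> norm (f (of_real s * cis \<theta>)) \<le> M * exp (b * s)"
  shows "growth_indicator \<alpha> f \<theta> \<le> ereal b"
proof -
  have "((\<lambda>s. ln M * inverse s + b) \<longlongrightarrow> ln M * 0 + b) at_top"
    by (intro tendsto_intros tendsto_inverse_0_at_top filterlim_ident)
  then have "((\<lambda>s. ereal (ln M * inverse s + b)) \<longlongrightarrow> ereal b) at_top"
    by simp
  then have "Limsup at_top (\<lambda>s. ereal (ln M * inverse s + b)) = ereal b"
    by (rule lim_imp_Limsup[OF trivial_limit_at_top_linorder])
  moreover have "growth_indicator \<alpha> f \<theta> \<le> Limsup at_top (\<lambda>s. ereal (ln M * inverse s + b))"
    unfolding growth_indicator_def
  proof (rule Limsup_mono, rule eventually_mono[OF eventually_ge_at_top[of 1]])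
    fix s :: real assume s: "1 \<le> s"
    define w where "w = f (of_real s * cis \<theta>)"
    have ext: "boundary_extension (sector \<alpha>) f (of_real s * cis \<theta>) = w"
      using cis_in_sector[OF assms(1,2), of s] s by (simp add: boundary_extension_def w_def)
    have "ln (norm w) / s \<le> ln M * inverse s + b" if "w \<noteq> 0"
    proof -
      have "ln (norm w) \<le> ln (M * exp (b * s))"
        using bound[OF s] that assms(3) by (subst ln_le_cancel_iff) (auto simp: w_def)
      also have "\<dots> = ln M + b * s" using assms(3) by (simp add: ln_mult)
      finally show ?thesis using s by (simp add: field_simps)
    qed
    then show "(let w = boundary_extension (sector \<alpha>) f (of_real s * cis \<theta>)
        in if w = 0 then - \<infinity> else ereal (ln (norm w) / s)) \<le> ereal (ln M * inverse s + b)"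
      unfolding ext by (simp add: Let_def)
  qed
  ultimately show ?thesis by simp
qed

section \<open>Laplace and Cauchy integrals of a function of exponential type\<close>

text \<open>Exponential type enters through a single bound; the rate \<open>a\<close> only decides
  how far to the left a point \<open>p\<close> must lie for integrals to converge. The theorem uses
  \<open>a = h + 1\<close>.\<close>

locale sector_function =
  fixes \<alpha> a C :: real and f :: "complex \<Rightarrow> complex"
  assumes \<alpha>: "0 < \<alpha>" "\<alpha> < pi / 2"
    and holo: "f holomorphic_on sector \<alpha>"
    and C: "0 < C"
    and bound: "\<And>\<zeta>. \<zeta> \<in> sector \<alpha> \<Longrightarrow> norm (f \<zeta>) \<le> C * exp (a * norm \<zeta>)"
begin

text \<open>The directional transform without its factor \<open>1 / (2 pi \<i>)\<close>, over the
  open ray, so that no boundary value of \<open>f\<close> enters.\<close>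

definition ray_laplace :: "real \<Rightarrow> complex \<Rightarrow> complex" where
  "ray_laplace \<phi> p = (LBINT t:{0<..}. f (of_real t * cis \<phi>) * cis \<phi> * exp (p * (of_real t * cis \<phi>)))"

text \<open>The exponential equals 1 at \<open>\<zeta> = z\<close>, so the residue there is
  \<open>f z\<close> for every \<open>p\<close>, while differentiation in \<open>p\<close> cancels
  the denominator.\<close>

definition ray_cauchy :: "complex \<Rightarrow> real \<Rightarrow> complex \<Rightarrow> complex" where
  "ray_cauchy z \<phi> p = (LBINT t:{0<..}. f (of_real t * cis \<phi>) * cis \<phi> / (of_real t * cis \<phi> - z) *
     exp (p * (of_real t * cis \<phi> - z)))"

text \<open>For such \<open>p\<close> the product \<open>f \<zeta> * exp (p * \<zeta>)\<close> is \<open>O(exp (- norm \<zeta>))\<close> on the whole sector, so that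
  contours can be rotated without a Phragmen--Lindelof argument.\<close>

definition deep :: "complex \<Rightarrow> bool" where
  "deep p \<longleftrightarrow> (\<forall>\<zeta>\<in>sector \<alpha>. Re (p * \<zeta>) \<le> - (a + 1) * norm \<zeta>)"

lemma in_sector: "\<bar>\<phi>\<bar> < \<alpha> \<Longrightarrow> 0 < t \<Longrightarrow> of_real t * cis \<phi> \<in> sector \<alpha>"
  using \<alpha> by (intro cis_in_sector)

lemma continuous_on_ray:
  assumes "g holomorphic_on sector \<alpha>" "\<bar>\<phi>\<bar> < \<alpha>"
  shows "continuous_on {0<..} (\<lambda>t. g (of_real t * cis \<phi>))"
  by (rule continuous_on_compose2[OF holomorphic_on_imp_continuous_on[OF assms(1)]])
    (auto intro!: continuous_intros in_sector assms(2))

lemma bound_ray: "\<bar>\<phi>\<bar> < \<alpha> \<Longrightarrow> 0 < t \<Longrightarrow> norm (f (of_real t * cis \<phi>)) \<le> C * exp (a * t)"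
  using bound[OF in_sector[of \<phi> t]] by (simp add: norm_mult)

section \<open>Contour rotation and Cauchy's formula at deep points\<close>

lemma deep_bound:
  assumes "deep p" "\<zeta> \<in> sector \<alpha>"
  shows "norm (f \<zeta> * exp (p * \<zeta>)) \<le> C * exp (- norm \<zeta>)"
proof -
  have "norm (f \<zeta> * exp (p * \<zeta>)) \<le> C * exp (a * norm \<zeta>) * exp (- (a + 1) * norm \<zeta>)"
    unfolding norm_mult using assms C by (intro mult_mono bound) (auto simp: deep_def)
  also have "\<dots> = C * exp (a * norm \<zeta> + - (a + 1) * norm \<zeta>)"
    unfolding exp_add by simp
  also have "\<dots> = C * exp (- norm \<zeta>)" by (simp add: algebra_simps)
  finally show ?thesis .
qed

lemma deep_bound_ray:
  assumes "deep p" "\<bar>\<phi>\<bar> < \<alpha>" "0 < t"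
  shows "norm (f (of_real t * cis \<phi>) * exp (p * (of_real t * cis \<phi>))) \<le> C * exp (- 1 * t)"
  using deep_bound[OF assms(1) in_sector[OF assms(2,3)]] assms(3) by (simp add: norm_mult)

text \<open>These are the end conditions of \<open>primitive_chord_tendsto\<close>: near 0 the
  factor \<open>\<zeta>\<close> meets a bounded function, at infinity it loses against exponential
  decay.\<close>

lemma deep_tendsto:
  assumes "deep p"
  shows deep_tendsto_0: "((\<lambda>\<zeta>. \<zeta> * (f \<zeta> * exp (p * \<zeta>))) \<longlongrightarrow> 0) (at 0 within sector \<alpha>)"
    and deep_tendsto_infinity:
      "((\<lambda>\<zeta>. \<zeta> * (f \<zeta> * exp (p * \<zeta>))) \<longlongrightarrow> 0) (inf at_infinity (principal (sector \<alpha>)))"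
proof -
  have le: "norm (\<zeta> * (f \<zeta> * exp (p * \<zeta>))) \<le> norm \<zeta> * (C * exp (- norm \<zeta>))" if "\<zeta> \<in> sector \<alpha>" for \<zeta>
    using deep_bound[OF assms that] by (subst norm_mult) (rule mult_left_mono, auto)
  show "((\<lambda>\<zeta>. \<zeta> * (f \<zeta> * exp (p * \<zeta>))) \<longlongrightarrow> 0) (at 0 within sector \<alpha>)"
  proof (rule Lim_null_comparison)
    show "\<forall>\<^sub>F \<zeta> in at 0 within sector \<alpha>. norm (\<zeta> * (f \<zeta> * exp (p * \<zeta>))) \<le> norm \<zeta> * (C * exp (- norm \<zeta>))"
      using le by (auto simp: eventually_at_filter)
    show "((\<lambda>\<zeta>. norm \<zeta> * (C * exp (- norm \<zeta>))) \<longlongrightarrow> 0) (at 0 within sector \<alpha>)"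
      by (intro tendsto_eq_intros) auto
  qed
  show "((\<lambda>\<zeta>. \<zeta> * (f \<zeta> * exp (p * \<zeta>))) \<longlongrightarrow> 0) (inf at_infinity (principal (sector \<alpha>)))"
  proof (rule Lim_null_comparison)
    show "\<forall>\<^sub>F \<zeta> in inf at_infinity (principal (sector \<alpha>)).
        norm (\<zeta> * (f \<zeta> * exp (p * \<zeta>))) \<le> norm \<zeta> * (C * exp (- norm \<zeta>))"
      using le by (auto simp: eventually_inf_principal)
    have "((\<lambda>x::real. C * (x ^ 1 / exp x)) \<longlongrightarrow> C * 0) at_top"
      by (intro tendsto_intros tendsto_power_div_exp_0)
    then have "((\<lambda>x::real. x * (C * exp (- x))) \<longlongrightarrow> 0) at_top"
      by (simp add: exp_minus field_simps)
    from filterlim_compose[OF this filterlim_norm_at_top]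
    have "((\<lambda>\<zeta>::complex. norm \<zeta> * (C * exp (- norm \<zeta>))) \<longlongrightarrow> 0) at_infinity" .
    then show "((\<lambda>\<zeta>. norm \<zeta> * (C * exp (- norm \<zeta>))) \<longlongrightarrow> 0) (inf at_infinity (principal (sector \<alpha>)))"
      by (rule tendsto_mono[rotated]) simp
  qed
qed

text \<open>Cauchy's theorem for the wedge between two rays. The integrands are subtracted first, so
  that only the difference of the primitive along the rays needs limits, and both are 0.\<close>

lemma ray_laplace_deep_eq:
  assumes p: "deep p" and \<phi>: "\<bar>\<phi>\<^sub>1\<bar> < \<alpha>" "\<bar>\<phi>\<^sub>2\<bar> < \<alpha>"
  shows "ray_laplace \<phi>\<^sub>1 p = ray_laplace \<phi>\<^sub>2 p"
proof -
  define k where "k = (\<lambda>\<zeta>. f \<zeta> * exp (p * \<zeta>))"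
  have k: "k holomorphic_on sector \<alpha>"
    unfolding k_def by (intro holomorphic_intros holo)
  obtain P where P: "\<And>\<zeta>. \<zeta> \<in> sector \<alpha> \<Longrightarrow> (P has_field_derivative k \<zeta>) (at \<zeta>)"
    using holomorphic_convex_primitive'[OF convex_sector[OF \<alpha>] open_sector[OF \<alpha>] k]
      at_within_open[OF _ open_sector[OF \<alpha>]] by metis
  have int: "set_integrable lborel {0<..} (\<lambda>t. k (of_real t * cis \<phi>) * cis \<phi>)" if "\<bar>\<phi>\<bar> < \<alpha>" for \<phi>
  proof (rule exp_decay_set_integrable(1)[of 1])
    show "continuous_on {0<..} (\<lambda>t. k (of_real t * cis \<phi>) * cis \<phi>)"
      by (intro continuous_intros continuous_on_ray k that)
    show "norm (k (of_real t * cis \<phi>) * cis \<phi>) \<le> C * exp (- 1 * t)" if "0 < t" for t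
      using deep_bound_ray[OF p \<open>\<bar>\<phi>\<bar> < \<alpha>\<close> that] by (simp add: k_def norm_mult)
  qed simp
  have lim: "((\<lambda>\<zeta>. \<zeta> * k \<zeta>) \<longlongrightarrow> 0) (at 0 within sector \<alpha>)"
    "((\<lambda>\<zeta>. \<zeta> * k \<zeta>) \<longlongrightarrow> 0) (inf at_infinity (principal (sector \<alpha>)))"
    using deep_tendsto[OF p] by (simp_all only: k_def)
  have eq: "ray_laplace \<phi> p = (LBINT t:{0<..}. k (of_real t * cis \<phi>) * cis \<phi>)" for \<phi>
    unfolding ray_laplace_def k_def by (simp add: mult_ac)
  have "(LBINT t:{0<..}. k (of_real t * cis \<phi>\<^sub>1) * cis \<phi>\<^sub>1 - k (of_real t * cis \<phi>\<^sub>2) * cis \<phi>\<^sub>2) = 0 - 0"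
  proof (rule FTC_Ioi)
    show "((\<lambda>t. P (of_real t * cis \<phi>\<^sub>1) - P (of_real t * cis \<phi>\<^sub>2)) has_vector_derivative
        k (of_real t * cis \<phi>\<^sub>1) * cis \<phi>\<^sub>1 - k (of_real t * cis \<phi>\<^sub>2) * cis \<phi>\<^sub>2) (at t)" if "0 < t" for t
      using \<phi> that by (intro has_vector_derivative_diff has_vector_derivative_along_ray P in_sector)
    show "continuous_on {0<..} (\<lambda>t. k (of_real t * cis \<phi>\<^sub>1) * cis \<phi>\<^sub>1 - k (of_real t * cis \<phi>\<^sub>2) * cis \<phi>\<^sub>2)"
      by (intro continuous_intros continuous_on_ray k \<phi>)
    show "((\<lambda>t. P (of_real t * cis \<phi>\<^sub>1) - P (of_real t * cis \<phi>\<^sub>2)) \<longlongrightarrow> 0) (at_right 0)"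
      by (rule primitive_chord_tendsto_0[OF \<alpha> P \<phi> lim(1)])
    show "((\<lambda>t. P (of_real t * cis \<phi>\<^sub>1) - P (of_real t * cis \<phi>\<^sub>2)) \<longlongrightarrow> 0) at_top"
      by (rule primitive_chord_tendsto_infinity[OF \<alpha> P \<phi> lim(2)])
  qed (intro set_integral_diff int \<phi>)
  then show ?thesis
    using int[OF \<phi>(1)] int[OF \<phi>(2)] by (simp add: eq set_integral_diff)
qed

text \<open>Cauchy's integral formula for a wedge, without estimating arcs around \<open>z\<close>: subtracting
  \<open>f z / (\<zeta> - z) - f z / (\<zeta> + z)\<close> removes the pole of the integrand and keeps its decay; the integral of
  the subtracted term is read off its explicit logarithmic primitives.\<close>

lemma ray_cauchy_deep:
  assumes p: "deep p" and \<beta>: "0 < \<beta>" "\<bar>\<theta>\<bar> + \<beta> < \<alpha>" and z: "z = of_real s * cis \<theta>" "0 < s"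
  shows "ray_cauchy z (\<theta> - \<beta>) p - ray_cauchy z (\<theta> + \<beta>) p = 2 * of_real pi * \<i> * f z"
proof -
  let ?m = "\<theta> - \<beta>" and ?p = "\<theta> + \<beta>"
  have \<phi>: "\<bar>?m\<bar> < \<alpha>" "\<bar>?p\<bar> < \<alpha>" "\<bar>\<theta>\<bar> < \<alpha>" using \<beta> by auto
  have zS: "z \<in> sector \<alpha>" unfolding z by (intro in_sector \<phi> z)
  have z0: "z \<noteq> 0" using z by simp
  have sin: "0 < sin (?p - \<theta>)" "sin (?m - \<theta>) < 0"
    using \<beta> \<alpha> sin_gt_zero[of \<beta>] by auto
  have dist: "s * sin \<beta> \<le> norm (of_real t * cis \<phi> - z)" if "\<phi> = ?m \<or> \<phi> = ?p" for \<phi> t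
    using norm_diff_rays_ge[of s \<phi> \<theta> t] sin that by (auto simp: z)
  have sb: "0 < s * sin \<beta>" using sin z by simp
  have plus: "\<zeta> + z \<noteq> 0" if "\<zeta> \<in> sector \<alpha>" for \<zeta>
    using Re_pos_in_sector(2)[OF \<alpha> that] Re_pos_in_sector(2)[OF \<alpha> zS] by (auto simp: complex_eq_iff)
  \<comment> \<open>Divided by \<open>\<zeta> - z\<close>, the subtracted term is
    \<open>f z / (\<zeta> - z) - f z / (\<zeta> + z)\<close>; since \<open>N z = 0\<close>, the
    quotient \<open>k\<close> has a removable singularity.\<close>
  define N where "N = (\<lambda>\<zeta>. f \<zeta> * exp (p * (\<zeta> - z)) - f z * (2 * z / (\<zeta> + z)))"
  define k where "k = (\<lambda>\<zeta>. if \<zeta> = z then deriv N z else (N \<zeta> - N z) / (\<zeta> - z))"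
  have Nz: "N z = 0" using z0 by (simp add: N_def flip: mult_2)
  have "N holomorphic_on sector \<alpha>"
    unfolding N_def by (intro holomorphic_intros holo plus)
  then have k: "k holomorphic_on sector \<alpha>"
    unfolding k_def using zS open_sector[OF \<alpha>] by (intro pole_lemma) (simp_all add: interior_open)
  obtain P where P: "\<And>\<zeta>. \<zeta> \<in> sector \<alpha> \<Longrightarrow> (P has_field_derivative k \<zeta>) (at \<zeta>)"
    using holomorphic_convex_primitive'[OF convex_sector[OF \<alpha>] open_sector[OF \<alpha>] k]
      at_within_open[OF _ open_sector[OF \<alpha>]] by metis
  \<comment> \<open>A form of \<open>\<zeta> * k \<zeta>\<close> whose limits can be read off term
    by term: at 0 the two inverses cancel, at infinity each of them vanishes.\<close>
  define E where "E = (\<lambda>\<zeta>. \<zeta> * (f \<zeta> * exp (p * \<zeta>)) * exp (- p * z) * inverse (\<zeta> - z)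
    - f z * z * (inverse (\<zeta> + z) + inverse (\<zeta> - z)))"
  have kE: "\<zeta> * k \<zeta> = E \<zeta>" if "\<zeta> \<in> sector \<alpha>" "\<zeta> \<noteq> z" for \<zeta>
  proof -
    have k_eq: "k \<zeta> = N \<zeta> / (\<zeta> - z)" using that(2) Nz by (simp add: k_def)
    have exp_eq: "exp (p * (\<zeta> - z)) = exp (p * \<zeta>) * exp (- p * z)"
      unfolding exp_add[symmetric] by (simp add: algebra_simps)
    have "\<zeta> * k \<zeta> = \<zeta> * (f \<zeta> * exp (p * \<zeta>)) * exp (- p * z) * inverse (\<zeta> - z)
        - \<zeta> * (f z * (2 * z / (\<zeta> + z)) / (\<zeta> - z))"
      unfolding k_eq N_def exp_eq
      by (simp only: divide_inverse right_diff_distrib left_diff_distrib mult_ac)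
    also have "\<zeta> * (f z * (2 * z / (\<zeta> + z)) / (\<zeta> - z)) = f z * z * (inverse (\<zeta> + z) + inverse (\<zeta> - z))"
      using plus[OF that(1)] that(2) by (simp add: divide_simps)
    finally show ?thesis by (simp add: E_def)
  qed
  have lim0: "((\<lambda>\<zeta>. \<zeta> * k \<zeta>) \<longlongrightarrow> 0) (at 0 within sector \<alpha>)"
  proof (rule Lim_transform_eventually)
    have "(E \<longlongrightarrow> 0 * exp (- p * z) * inverse (0 - z) - f z * z * (inverse (0 + z) + inverse (0 - z)))
        (at 0 within sector \<alpha>)"
      unfolding E_def using z0 by (intro tendsto_intros deep_tendsto_0[OF p]) auto
    then show "(E \<longlongrightarrow> 0) (at 0 within sector \<alpha>)" by simp
    have "\<forall>\<^sub>F \<zeta> in at 0 within sector \<alpha>. \<zeta> \<noteq> z"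
      using z0 by (intro tendsto_imp_eventually_ne[OF tendsto_ident_at]) auto
    moreover have "\<forall>\<^sub>F \<zeta> in at 0 within sector \<alpha>. \<zeta> \<in> sector \<alpha>"
      by (simp add: eventually_at_filter)
    ultimately show "\<forall>\<^sub>F \<zeta> in at 0 within sector \<alpha>. E \<zeta> = \<zeta> * k \<zeta>"
      by eventually_elim (simp add: kE)
  qed
  have liminf: "((\<lambda>\<zeta>. \<zeta> * k \<zeta>) \<longlongrightarrow> 0) (inf at_infinity (principal (sector \<alpha>)))"
  proof (rule Lim_transform_eventually)
    let ?F = "inf at_infinity (principal (sector \<alpha>))"
    have id: "filterlim (\<lambda>\<zeta>. \<zeta>) at_infinity ?F"
      by (simp add: filterlim_def)
    have "filterlim (\<lambda>\<zeta>. \<zeta> - z) at_infinity ?F" "filterlim (\<lambda>\<zeta>. \<zeta> + z) at_infinity ?F"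
      using tendsto_add_filterlim_at_infinity[OF tendsto_const id, of "- z"]
        tendsto_add_filterlim_at_infinity[OF tendsto_const id, of z] by (simp_all add: add.commute)
    then have "(E \<longlongrightarrow> 0 * exp (- p * z) * 0 - f z * z * (0 + 0)) ?F"
      unfolding E_def
      by (intro tendsto_intros deep_tendsto_infinity[OF p] filterlim_compose[OF tendsto_inverse_0])
    then show "(E \<longlongrightarrow> 0) ?F" by simp
    have "\<forall>\<^sub>F \<zeta> in ?F. \<zeta> \<noteq> z"
      using eventually_not_equal_at_infinity[of z] by (simp add: eventually_inf_principal eventually_mono)
    moreover have "\<forall>\<^sub>F \<zeta> in ?F. \<zeta> \<in> sector \<alpha>"
      by (simp add: eventually_inf_principal)
    ultimately show "\<forall>\<^sub>F \<zeta> in ?F. E \<zeta> = \<zeta> * k \<zeta>"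
      by eventually_elim (simp add: kE)
  qed
  define k1 where "k1 = (\<lambda>\<phi> t. f (of_real t * cis \<phi>) * cis \<phi> / (of_real t * cis \<phi> - z) *
     exp (p * (of_real t * cis \<phi> - z)))"
  have nz: "of_real t * cis \<phi> \<noteq> z" if "\<phi> = ?m \<or> \<phi> = ?p" for \<phi> t
    using dist[OF that, of t] sb by auto
  have cont: "continuous_on {0<..} (k1 \<phi>)" if "\<phi> = ?m \<or> \<phi> = ?p" for \<phi>
    unfolding k1_def using nz[OF that] that \<phi>
    by (intro continuous_intros continuous_on_ray holo) auto
  have int: "set_integrable lborel {0<..} (k1 \<phi>)" if mp: "\<phi> = ?m \<or> \<phi> = ?p" for \<phi>
  proof (rule exp_decay_set_integrable(1)[of 1 _ "C * (norm (exp (- p * z)) / (s * sin \<beta>))"])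
    show "norm (k1 \<phi> t) \<le> C * (norm (exp (- p * z)) / (s * sin \<beta>)) * exp (- 1 * t)" if t: "0 < t" for t
    proof -
      have "k1 \<phi> t = (f (of_real t * cis \<phi>) * exp (p * (of_real t * cis \<phi>))) *
          (exp (- p * z) / (of_real t * cis \<phi> - z)) * cis \<phi>"
        by (simp add: k1_def right_diff_distrib exp_diff exp_minus divide_inverse mult_ac)
      then have "norm (k1 \<phi> t) = norm (f (of_real t * cis \<phi>) * exp (p * (of_real t * cis \<phi>))) *
          (norm (exp (- p * z)) / norm (of_real t * cis \<phi> - z))"
        by (simp add: norm_mult norm_divide)
      also have "\<dots> \<le> (C * exp (- 1 * t)) * (norm (exp (- p * z)) / (s * sin \<beta>))"
        using dist[OF mp, of t] sb C \<phi> mp t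
        by (intro mult_mono deep_bound_ray[OF p] frac_le) auto
      finally show ?thesis by (simp add: mult_ac)
    qed
  qed (use cont mp in auto)
  \<comment> \<open>\<open>P\<close> accounts for the regular part and the logarithms for the pole.
    The lower ray needs \<open>- \<i>\<close> and the upper one \<open>\<i>\<close>, according to
    the sign of \<open>sin (\<phi> - \<theta>)\<close>.\<close>
  define D where "D = (\<lambda>t. P (of_real t * cis ?m) - P (of_real t * cis ?p)
     + f z * (Ln (- \<i> * (z - of_real t * cis ?m) / (z + of_real t * cis ?m))
            - Ln (\<i> * (z - of_real t * cis ?p) / (z + of_real t * cis ?p))))"
  have plus_ray: "of_real t * cis \<phi> + z \<noteq> 0" if "\<phi> = ?m \<or> \<phi> = ?p" "0 < t" for \<phi> t
    using that \<phi> by (intro plus in_sector) auto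
  note log_m = log_along_ray[OF z plus_ray[of ?m], of _ "- \<i>"]
  note log_p = log_along_ray[OF z plus_ray[of ?p], of _ \<i>]
  have k_k1: "k1 \<phi> t = k (of_real t * cis \<phi>) * cis \<phi>
      + f z * ((1 / (of_real t * cis \<phi> - z) - 1 / (of_real t * cis \<phi> + z)) * cis \<phi>)"
    if "\<phi> = ?m \<or> \<phi> = ?p" "0 < t" for \<phi> t
    using nz[OF that(1), of t] plus_ray[OF that] z0
    by (simp add: k_def Nz N_def k1_def divide_simps) (simp add: algebra_simps)
  \<comment> \<open>The residue appears here: the logarithms contribute \<open>pi * \<i>\<close> at
    infinity and \<open>- pi * \<i>\<close> at 0, both times \<open>f z\<close>.\<close>
  have "(LBINT t:{0<..}. k1 ?m t - k1 ?p t) =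
      (0 + f z * (Ln (- (- \<i>)) - Ln (- \<i>))) - (0 + f z * (Ln (- \<i>) - Ln \<i>))"
  proof (rule FTC_Ioi[where F = D])
    show "(D has_vector_derivative k1 ?m t - k1 ?p t) (at t)" if t: "0 < t" for t
    proof -
      have "(D has_vector_derivative (k (of_real t * cis ?m) * cis ?m - k (of_real t * cis ?p) * cis ?p)
        + f z * ((1 / (of_real t * cis ?m - z) - 1 / (of_real t * cis ?m + z)) * cis ?m
              - (1 / (of_real t * cis ?p - z) - 1 / (of_real t * cis ?p + z)) * cis ?p)) (at t)"
        unfolding D_def using t \<phi> sin
        by (intro has_vector_derivative_add has_vector_derivative_diff has_vector_derivative_along_ray P
            in_sector has_vector_derivative_mult_right log_m(1) log_p(1)) auto
      then show ?thesis
        using t by (simp only: k_k1 simp_thms add_diff_add right_diff_distrib)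
    qed
    show "continuous_on {0<..} (\<lambda>t. k1 ?m t - k1 ?p t)"
      by (intro continuous_on_diff cont) auto
    show "set_integrable lborel {0<..} (\<lambda>t. k1 ?m t - k1 ?p t)"
      by (intro set_integral_diff int) auto
    show "(D \<longlongrightarrow> 0 + f z * (Ln (- \<i>) - Ln \<i>)) (at_right 0)"
      unfolding D_def using sin
      by (intro tendsto_add tendsto_diff tendsto_mult tendsto_const
          primitive_chord_tendsto_0[OF \<alpha> P \<phi>(1,2) lim0] log_m(2) log_p(2)) auto
    show "(D \<longlongrightarrow> 0 + f z * (Ln (- (- \<i>)) - Ln (- \<i>))) at_top"
      unfolding D_def using sin
      by (intro tendsto_add tendsto_diff tendsto_mult tendsto_const
          primitive_chord_tendsto_infinity[OF \<alpha> P \<phi>(1,2) liminf] log_m(3) log_p(3)) auto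
  qed
  moreover have "(LBINT t:{0<..}. k1 ?m t - k1 ?p t) = ray_cauchy z ?m p - ray_cauchy z ?p p"
    using int[of ?m] int[of ?p] by (simp add: set_integral_diff ray_cauchy_def k1_def)
  ultimately show ?thesis
    by (simp add: algebra_simps)
qed

section \<open>Comparison with the concatenated transform\<close>

lemma growth_indicator_le_type: "\<bar>\<phi>\<bar> < \<alpha> \<Longrightarrow> growth_indicator \<alpha> f \<phi> \<le> ereal a"
  using \<alpha> C by (intro growth_indicator_le[where M = C] bound_ray) auto

text \<open>On an interior ray the extension is \<open>f\<close>, except at 0, which is a null set;
  Borel measurability of the integrand lets the completed measure be replaced by
  \<open>lborel\<close>.\<close>

lemma directional_laplace_eq:
  assumes "\<bar>\<phi>\<bar> < \<alpha>"
  shows "directional_laplace \<alpha> f \<phi> p = ray_laplace \<phi> p / (2 * of_real pi * \<i>)"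
proof -
  define u where "u = (\<lambda>t. f (of_real t * cis \<phi>) * cis \<phi> * exp (p * (of_real t * cis \<phi>)))"
  define v where "v = (\<lambda>t. boundary_extension (sector \<alpha>) f (of_real t * cis \<phi>)
    * exp (p * (of_real t * cis \<phi>)) * cis \<phi>)"
  have uv: "v t = u t" if "0 < t" for t
    using in_sector[OF assms that] by (simp add: u_def v_def boundary_extension_def)
  have "continuous_on {0<..} u"
    unfolding u_def by (intro continuous_intros continuous_on_ray holo assms)
  then have meas: "(\<lambda>t. indicator {0<..} t *\<^sub>R u t) \<in> borel_measurable lborel"
    by (simp add: borel_measurable_continuous_on_indicator)
  \<comment> \<open>Splitting off the value at 0 gives measurability whatever the boundary extension
    assigns there.\<close>
  have *: "indicator {0..} t *\<^sub>R v t = indicator {0<..} t *\<^sub>R u t + indicator {0} t *\<^sub>R v 0" for t :: real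
    by (auto simp: uv split: split_indicator)
  have meas': "(\<lambda>t. indicator {0..} t *\<^sub>R v t) \<in> borel_measurable lborel"
    unfolding * using meas by (intro borel_measurable_add) auto
  have "(LINT t:{0..}|lebesgue. v t) = integral\<^sup>L lborel (\<lambda>t. indicator {0..} t *\<^sub>R v t)"
    unfolding set_lebesgue_integral_def by (rule integral_completion[OF meas'])
  also have "\<dots> = (LBINT t:{0<..}. u t)"
    unfolding set_lebesgue_integral_def
  proof (rule integral_cong_AE[OF meas' meas])
    show "AE t in lborel. indicator {0..} t *\<^sub>R v t = indicator {0<..} t *\<^sub>R u t"
      using AE_lborel_singleton[of 0] by eventually_elim (simp only: *, simp)
  qed
  finally show ?thesis
    by (simp add: directional_laplace_def ray_laplace_def u_def v_def)
qed

lemma deep_laplace_half_plane: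
  assumes "deep p" "\<bar>\<phi>\<bar> < \<alpha>"
  shows "p \<in> laplace_half_plane \<alpha> f \<phi>"
proof -
  have "Re (p * (of_real 1 * cis \<phi>)) \<le> - (a + 1) * norm (of_real 1 * cis \<phi>)"
    using assms(1) in_sector[OF assms(2), of 1] unfolding deep_def by auto
  then have "Re (p * cis \<phi>) < - a" by simp
  then have "ereal (Re (p * cis \<phi>)) < - ereal a" by simp
  also have "\<dots> \<le> - growth_indicator \<alpha> f \<phi>"
    using growth_indicator_le_type[OF assms(2)] by (simp only: ereal_minus_le_minus)
  finally show ?thesis by (simp add: laplace_half_plane_def)
qed

text \<open>At a deep point every interior direction is admissible, so \<open>SOME\<close> yields an
  unknown interior \<open>\<psi>\<close>; contour rotation trades it for
  \<open>\<phi>\<close>.\<close>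

lemma concat_laplace_deep:
  assumes "deep p" "\<bar>\<phi>\<bar> < \<alpha>"
  shows "concat_laplace \<alpha> f p = ray_laplace \<phi> p / (2 * of_real pi * \<i>)"
    and "p \<in> laplace_domain \<alpha> f"
proof -
  have *: "\<exists>\<phi>. \<bar>\<phi>\<bar> < \<alpha> \<and> p \<in> laplace_half_plane \<alpha> f \<phi>"
    using assms deep_laplace_half_plane by blast
  define \<psi> where "\<psi> = (SOME \<phi>. \<bar>\<phi>\<bar> < \<alpha> \<and> p \<in> laplace_half_plane \<alpha> f \<phi>)"
  have \<psi>: "\<bar>\<psi>\<bar> < \<alpha>"
    using someI_ex[OF *] by (simp add: \<psi>_def)
  have "concat_laplace \<alpha> f p = directional_laplace \<alpha> f \<psi> p"
    using * by (simp add: concat_laplace_def \<psi>_def)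
  then show "concat_laplace \<alpha> f p = ray_laplace \<phi> p / (2 * of_real pi * \<i>)"
    by (simp only: directional_laplace_eq[OF \<psi>] ray_laplace_deep_eq[OF assms(1) \<psi> assms(2)])
  show "p \<in> laplace_domain \<alpha> f"
    using deep_laplace_half_plane[OF assms] assms(2) by (force simp: laplace_domain_def)
qed

text \<open>As \<open>Re \<zeta> \<ge> norm \<zeta> * cos \<alpha>\<close> on the sector,
  multiplication by \<open>- R\<close> gains \<open>R * cos \<alpha>\<close>. Of the required
  \<open>\<bar>a\<bar> + 2\<close>, one unit pays for the radius of the ball. A whole ball is wanted
  for the identity theorem.\<close>

lemma deep_ball:
  obtains R where "R\<^sub>0 \<le> R" "\<And>p. p \<in> ball (- of_real R) 1 \<Longrightarrow> deep p"
proof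
  have c: "0 < cos \<alpha>" using \<alpha> by (intro cos_gt_zero_pi) auto
  define R where "R = max R\<^sub>0 ((\<bar>a\<bar> + 2) / cos \<alpha>)"
  show "R\<^sub>0 \<le> R" by (simp add: R_def)
  have R: "\<bar>a\<bar> + 2 \<le> R * cos \<alpha>"
    using c by (simp add: R_def flip: pos_divide_le_eq)
  then have R0: "0 \<le> R" using c by (smt (verit) zero_le_mult_iff)
  show "deep p" if "p \<in> ball (- of_real R) 1" for p
    unfolding deep_def
  proof
    fix \<zeta> assume \<zeta>: "\<zeta> \<in> sector \<alpha>"
    have "Re (p * \<zeta>) = Re ((p + of_real R) * \<zeta>) - R * Re \<zeta>"
      by (simp add: algebra_simps)
    also have "\<dots> \<le> norm ((p + of_real R) * \<zeta>) - R * (norm \<zeta> * cos \<alpha>)"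
      using Re_pos_in_sector(1)[OF \<alpha> \<zeta>] R0 by (intro diff_mono complex_Re_le_cmod mult_left_mono)
    also have "\<dots> \<le> 1 * norm \<zeta> - (\<bar>a\<bar> + 2) * norm \<zeta>"
    proof (rule diff_mono)
      have "norm (p + of_real R) \<le> 1"
        using that by (simp add: dist_norm norm_minus_commute[of _ p])
      then show "norm ((p + of_real R) * \<zeta>) \<le> 1 * norm \<zeta>"
        unfolding norm_mult by (rule mult_right_mono) simp
      have "(\<bar>a\<bar> + 2) * norm \<zeta> \<le> R * cos \<alpha> * norm \<zeta>"
        using R by (intro mult_right_mono) auto
      then show "(\<bar>a\<bar> + 2) * norm \<zeta> \<le> R * (norm \<zeta> * cos \<alpha>)" by (simp add: mult_ac)
    qed
    also have "\<dots> = - (\<bar>a\<bar> + 1) * norm \<zeta>" by (simp add: algebra_simps)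
    also have "\<dots> \<le> - (a + 1) * norm \<zeta>" by (intro mult_right_mono) auto
    finally show "Re (p * \<zeta>) \<le> - (a + 1) * norm \<zeta>" .
  qed
qed

section \<open>The Cauchy integrals as functions of \<open>p\<close>\<close>

text \<open>The integral is \<open>exp (- p * z)\<close> times a Laplace integral \<open>L\<close>
  at \<open>p * cis \<phi>\<close>. The product rule inserts \<open>\<zeta> - z\<close> under the
  integral, which cancels the denominator; \<open>d\<close> bounds that denominator from
  below.\<close>

lemma ray_cauchy_has_field_derivative:
  assumes \<phi>: "\<bar>\<phi>\<bar> < \<alpha>" and p: "Re (p * cis \<phi>) < - a"
    and d: "0 < d" "\<And>t. d \<le> norm (of_real t * cis \<phi> - z)"
  shows "(ray_cauchy z \<phi> has_field_derivative exp (- p * z) * ray_laplace \<phi> p) (at p)"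
proof -
  define u where "u = (\<lambda>t. f (of_real t * cis \<phi>) * cis \<phi> / (of_real t * cis \<phi> - z))"
  define v where "v = (\<lambda>t. f (of_real t * cis \<phi>) * cis \<phi>)"
  have nz: "of_real t * cis \<phi> - z \<noteq> 0" for t using d(1) d(2)[of t] by auto
  have contu: "continuous_on {0<..} u"
    unfolding u_def using nz by (intro continuous_intros continuous_on_ray holo \<phi>) auto
  have bu: "norm (u t) \<le> C / d * exp (a * t)" if "0 < t" for t
  proof -
    have "norm (u t) = norm (f (of_real t * cis \<phi>)) / norm (of_real t * cis \<phi> - z)"
      by (simp add: u_def norm_mult norm_divide)
    also have "\<dots> \<le> C * exp (a * t) / d"
      using C d bound_ray[OF \<phi> that] by (intro frac_le) auto
    finally show ?thesis by simp
  qed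
  define L where "L = (\<lambda>w. LBINT t:{0<..}. u t * exp (w * of_real t))"
  define L' where "L' = (LBINT t:{0<..}. u t * of_real t * exp (p * cis \<phi> * of_real t))"
  have L: "(L has_field_derivative L') (at (p * cis \<phi>))"
    unfolding L_def L'_def by (rule laplace_has_field_derivative[OF contu bu p])
  have "((\<lambda>p. p * cis \<phi>) has_field_derivative cis \<phi>) (at p)"
    by (auto intro!: derivative_eq_intros)
  from DERIV_chain2[OF L this]
  have "((\<lambda>p. L (p * cis \<phi>)) has_field_derivative L' * cis \<phi>) (at p)" .
  then have "((\<lambda>p. exp (- p * z) * L (p * cis \<phi>)) has_field_derivative
      exp (- p * z) * (L' * cis \<phi> - z * L (p * cis \<phi>))) (at p)"
    by (auto intro!: derivative_eq_intros simp: algebra_simps)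
  moreover have "ray_cauchy z \<phi> = (\<lambda>p. exp (- p * z) * L (p * cis \<phi>))"
  proof
    fix p
    have "exp (p * (of_real t * cis \<phi> - z)) = exp (- p * z) * exp (p * cis \<phi> * of_real t)" for t
      unfolding exp_add[symmetric] by (simp add: algebra_simps)
    then have "ray_cauchy z \<phi> p = (LBINT t:{0<..}. exp (- p * z) * (u t * exp (p * cis \<phi> * of_real t)))"
      unfolding ray_cauchy_def u_def by (simp only: mult_ac)
    also have "\<dots> = exp (- p * z) * L (p * cis \<phi>)"
      unfolding L_def by (rule set_integral_mult_right)
    finally show "ray_cauchy z \<phi> p = exp (- p * z) * L (p * cis \<phi>)" .
  qed
  moreover have "L' * cis \<phi> - z * L (p * cis \<phi>) = ray_laplace \<phi> p"
  proof -
    have int: "set_integrable lborel {0<..} (\<lambda>t. u t * exp (p * cis \<phi> * of_real t))"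
      "set_integrable lborel {0<..} (\<lambda>t. u t * of_real t * exp (p * cis \<phi> * of_real t))"
      using laplace_set_integrable[OF contu bu p] laplace_deriv_set_integrable[OF contu bu p] by auto
    have "L' * cis \<phi> - z * L (p * cis \<phi>) = (LBINT t:{0<..}.
        cis \<phi> * (u t * of_real t * exp (p * cis \<phi> * of_real t)) - z * (u t * exp (p * cis \<phi> * of_real t)))"
      using int by (simp add: L_def L'_def set_integral_diff)
    also have "(\<lambda>t. cis \<phi> * (u t * of_real t * exp (p * cis \<phi> * of_real t))
          - z * (u t * exp (p * cis \<phi> * of_real t)))
        = (\<lambda>t. f (of_real t * cis \<phi>) * cis \<phi> * exp (p * (of_real t * cis \<phi>)))"
    proof
      fix t
      have "cis \<phi> * (u t * of_real t * exp (p * cis \<phi> * of_real t)) - z * (u t * exp (p * cis \<phi> * of_real t))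
          = u t * (of_real t * cis \<phi> - z) * exp (p * cis \<phi> * of_real t)"
        by (simp only: right_diff_distrib left_diff_distrib mult_ac)
      also have "u t * (of_real t * cis \<phi> - z) = f (of_real t * cis \<phi>) * cis \<phi>"
        using nz[of t] by (simp add: u_def)
      finally show "cis \<phi> * (u t * of_real t * exp (p * cis \<phi> * of_real t))
          - z * (u t * exp (p * cis \<phi> * of_real t))
        = f (of_real t * cis \<phi>) * cis \<phi> * exp (p * (of_real t * cis \<phi>))"
        by (simp only: mult_ac)
    qed
    finally show ?thesis by (simp add: ray_laplace_def)
  qed
  ultimately show ?thesis by simp
qed

text \<open>The margin 1 in \<open>Re (p * cis \<phi>)\<close> leaves the integrand
  \<open>exp (- t)\<close>. Thus \<open>z\<close> enters only through \<open>d\<close> and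
  \<open>exp (- Re (p * z))\<close>.\<close>

lemma ray_cauchy_bound:
  assumes \<phi>: "\<bar>\<phi>\<bar> < \<alpha>" and p: "Re (p * cis \<phi>) \<le> - a - 1"
    and d: "0 < d" "\<And>t. d \<le> norm (of_real t * cis \<phi> - z)"
  shows "norm (ray_cauchy z \<phi> p) \<le> C / d * exp (- Re (p * z)) * (LBINT t:{0<..}. exp (- 1 * t))"
  unfolding ray_cauchy_def
proof (rule exp_decay_set_integrable(2))
  have "of_real t * cis \<phi> - z \<noteq> 0" for t using d(1) d(2)[of t] by auto
  then show "continuous_on {0<..} (\<lambda>t. f (of_real t * cis \<phi>) * cis \<phi> / (of_real t * cis \<phi> - z) *
     exp (p * (of_real t * cis \<phi> - z)))"
    by (intro continuous_intros continuous_on_ray holo \<phi>) auto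
  fix t :: real assume t: "0 < t"
  have "Re (p * (of_real t * cis \<phi> - z)) = t * Re (p * cis \<phi>) - Re (p * z)"
    by (simp add: algebra_simps)
  also have "\<dots> \<le> t * (- a - 1) - Re (p * z)"
    using t p by (intro diff_right_mono mult_left_mono) auto
  finally have "norm (exp (p * (of_real t * cis \<phi> - z))) \<le> exp (t * (- a - 1) - Re (p * z))"
    by simp
  then have "norm (f (of_real t * cis \<phi>) * cis \<phi> / (of_real t * cis \<phi> - z) *
     exp (p * (of_real t * cis \<phi> - z))) \<le> (C * exp (a * t) / d) * exp (t * (- a - 1) - Re (p * z))"
    unfolding norm_mult norm_divide using C d bound_ray[OF \<phi> t]
    by (intro mult_mono[OF frac_le]) auto
  also have "\<dots> = C / d * (exp (a * t) * exp (t * (- a - 1) - Re (p * z)))" by simp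
  also have "\<dots> = C / d * (exp (- Re (p * z)) * exp (- 1 * t))"
    unfolding exp_add[symmetric] by (simp add: algebra_simps)
  finally show "norm (f (of_real t * cis \<phi>) * cis \<phi> / (of_real t * cis \<phi> - z) *
     exp (p * (of_real t * cis \<phi> - z))) \<le> C / d * exp (- Re (p * z)) * exp (- 1 * t)"
    by simp
qed simp

text \<open>\<open>G\<close> is assumed to agree with the transform only on a ball. There the
  difference \<open>Q\<close> has derivative 0; on the connected set \<open>W\<close> it is
  holomorphic, so the identity theorem spreads its constancy.\<close>

lemma ray_cauchy_minus_primitive_constant:
  assumes \<phi>: "\<bar>\<phi>\<bar> < \<alpha>" and d: "0 < d" "\<And>t. d \<le> norm (of_real t * cis \<phi> - z)"
    and H: "open H" "convex H"
    and P: "\<And>p. p \<in> H \<Longrightarrow> (P has_field_derivative G p * exp (- p * z)) (at p)"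
    and B: "\<And>p. p \<in> ball p\<^sub>0 1 \<Longrightarrow> p \<in> H \<and> deep p \<and> G p = ray_laplace \<phi> p / (2 * of_real pi * \<i>)"
    and p: "p \<in> H" "Re (p * cis \<phi>) < - a"
  shows "ray_cauchy z \<phi> p - 2 * of_real pi * \<i> * P p = ray_cauchy z \<phi> p\<^sub>0 - 2 * of_real pi * \<i> * P p\<^sub>0"
proof -
  define W where "W = H \<inter> {p. Re (p * cis \<phi>) < - a}"
  define Q where "Q = (\<lambda>p. ray_cauchy z \<phi> p - 2 * of_real pi * \<i> * P p)"
  have W: "open W" "convex W"
    unfolding W_def by (intro open_Int convex_Int H open_convex_rotated_half_plane)+
  have dQ: "(Q has_field_derivative
      exp (- p * z) * ray_laplace \<phi> p - 2 * of_real pi * \<i> * (G p * exp (- p * z))) (at p)"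
    if "p \<in> W" for p
    unfolding Q_def using that
    by (intro DERIV_diff DERIV_cmult P ray_cauchy_has_field_derivative[OF \<phi> _ d]) (auto simp: W_def)
  have BW: "p \<in> W" if "p \<in> ball p\<^sub>0 1" for p
  proof -
    \<comment> \<open>Depth is tested at the unit vector \<open>cis \<phi>\<close>, which gives
      \<open>Re (p * cis \<phi>) \<le> - a - 1\<close>.\<close>
    have "Re (p * (of_real 1 * cis \<phi>)) \<le> - (a + 1) * norm (of_real 1 * cis \<phi>)"
      using B[OF that] in_sector[OF \<phi>, of 1] unfolding deep_def by auto
    then show ?thesis using B[OF that] by (simp add: W_def)
  qed
  have "\<exists>c. \<forall>p\<in>ball p\<^sub>0 1. Q p = c"
  proof (rule has_field_derivative_zero_constant)
    show "(Q has_field_derivative 0) (at p within ball p\<^sub>0 1)" if "p \<in> ball p\<^sub>0 1" for p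
      using dQ[OF BW[OF that]] B[OF that] by (simp add: has_field_derivative_at_within)
  qed simp
  then obtain c where c: "\<And>p. p \<in> ball p\<^sub>0 1 \<Longrightarrow> Q p = c" by blast
  have "Q p = c" if "p \<in> W" for p
  proof (rule analytic_continuation_open[of "ball p\<^sub>0 1" W Q "\<lambda>_. c"])
    show "Q holomorphic_on W"
      using dQ W(1) by (auto simp: holomorphic_on_open)
  qed (use W BW c that convex_connected in auto)
  moreover have "p \<in> W" using p by (simp add: W_def)
  ultimately have "Q p = Q p\<^sub>0" using BW[of p\<^sub>0] by simp
  then show ?thesis by (simp add: Q_def)
qed

section \<open>Decay of \<open>f\<close> forced by a continuation\<close>

text \<open>The points, the segment joining them and all constants are fixed before
  \<open>s\<close>, which enters only through \<open>z\<close> and \<open>P\<close>. On the line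
  \<open>Re (p * cis \<theta>) = q\<close> the norm of \<open>exp (- p * z)\<close> is exactly
  \<open>exp (- q * s)\<close>.\<close>

lemma continuation_decay:
  assumes \<theta>: "\<bar>\<theta>\<bar> < \<alpha>"
    and G: "G holomorphic_on {\<omega>. Re (\<omega> * cis \<theta>) < b}"
    and eq: "\<And>\<omega>. \<omega> \<in> laplace_domain \<alpha> f \<Longrightarrow> Re (\<omega> * cis \<theta>) < b \<Longrightarrow> G \<omega> = concat_laplace \<alpha> f \<omega>"
    and q: "q < b"
  obtains M where "0 < M" "\<And>s. 1 \<le> s \<Longrightarrow> norm (f (of_real s * cis \<theta>)) \<le> M * exp (- q * s)"
proof -
  define H where "H = {\<omega>. Re (\<omega> * cis \<theta>) < b}"
  have H: "open H" "convex H" unfolding H_def by (rule open_convex_rotated_half_plane)+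
  have c\<theta>: "0 < cos \<theta>" using \<theta> \<alpha> by (intro cos_gt_zero_pi) auto
  \<comment> \<open>The bound on \<open>R\<close> moves the unit ball into \<open>H\<close>: there
    \<open>Re (p * cis \<theta>) < 1 - R * cos \<theta> \<le> - \<bar>b\<bar>\<close>.\<close>
  obtain R where R: "(1 + \<bar>b\<bar>) / cos \<theta> \<le> R" "\<And>p. p \<in> ball (- of_real R) 1 \<Longrightarrow> deep p"
    using deep_ball by blast
  define p\<^sub>0 where "p\<^sub>0 = (- of_real R :: complex)"
  have BH: "p \<in> H" if "p \<in> ball p\<^sub>0 1" for p
  proof -
    have "Re (p * cis \<theta>) = Re ((p + of_real R) * cis \<theta>) - R * cos \<theta>"
      by (simp add: algebra_simps)
    also have "\<dots> \<le> norm ((p + of_real R) * cis \<theta>) - R * cos \<theta>"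
      by (intro diff_right_mono complex_Re_le_cmod)
    also have "\<dots> < 1 - (1 + \<bar>b\<bar>)"
    proof -
      have "norm ((p + of_real R) * cis \<theta>) < 1"
        using that by (simp add: p\<^sub>0_def norm_mult dist_norm norm_minus_commute[of _ p])
      moreover have "1 + \<bar>b\<bar> \<le> R * cos \<theta>" using R(1) c\<theta> by (simp add: field_simps)
      ultimately show ?thesis by linarith
    qed
    finally show ?thesis by (auto simp: H_def)
  qed
  define \<beta> where "\<beta> = (\<alpha> - \<bar>\<theta>\<bar>) / 2"
  have \<beta>: "0 < \<beta>" "\<bar>\<theta>\<bar> + \<beta> < \<alpha>" using \<theta> by (simp_all add: \<beta>_def field_simps)
  have \<phi>: "\<bar>\<theta> - \<beta>\<bar> < \<alpha>" "\<bar>\<theta> + \<beta>\<bar> < \<alpha>" using \<beta> by auto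
  have sin: "0 < sin \<beta>" using \<beta> \<alpha> by (intro sin_gt_zero) auto
  \<comment> \<open>Tilting by \<open>\<beta>\<close> gives real part
    \<open>q * cos \<beta> - Y * sin \<beta>\<close> for \<open>p\<^sub>1\<close> on the lower and
    \<open>p\<^sub>2\<close> on the upper ray; this \<open>Y\<close> brings it to at most
    \<open>- a - 1\<close>, where the Cauchy integrals converge.\<close>
  define Y where "Y = (\<bar>a + 1\<bar> + \<bar>q\<bar>) / sin \<beta>"
  have Y: "0 \<le> Y" "\<bar>a + 1\<bar> + \<bar>q\<bar> = Y * sin \<beta>" using sin by (auto simp: Y_def)
  have qY: "q * cos \<beta> - Y * sin \<beta> \<le> - a - 1"
  proof -
    have "q * cos \<beta> \<le> \<bar>q\<bar> * \<bar>cos \<beta>\<bar>" by (metis abs_ge_self abs_mult)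
    also have "\<dots> \<le> \<bar>q\<bar> * 1" by (intro mult_left_mono) auto
    finally show ?thesis using Y(2) by linarith
  qed
  define p\<^sub>1 where "p\<^sub>1 = Complex q (- Y) * cis (- \<theta>)"
  define p\<^sub>2 where "p\<^sub>2 = Complex q Y * cis (- \<theta>)"
  have p1: "Re (p\<^sub>1 * cis (\<theta> - \<beta>)) \<le> - a - 1" and p2: "Re (p\<^sub>2 * cis (\<theta> + \<beta>)) \<le> - a - 1"
    using qY by (simp_all add: p\<^sub>1_def p\<^sub>2_def mult.assoc cis_mult)
  have p12: "Re (p\<^sub>1 * cis \<theta>) = q" "Re (p\<^sub>2 * cis \<theta>) = q"
    by (simp_all add: p\<^sub>1_def p\<^sub>2_def mult.assoc cis_mult)
  let ?S = "closed_segment p\<^sub>1 p\<^sub>2"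
  have seg: "Re (\<omega> * cis \<theta>) = q" if "\<omega> \<in> ?S" for \<omega>
  proof -
    obtain u where \<omega>: "\<omega> = (1 - u) *\<^sub>R p\<^sub>1 + u *\<^sub>R p\<^sub>2" using \<open>\<omega> \<in> ?S\<close> by (auto simp: closed_segment_def)
    have "Re (\<omega> * cis \<theta>) = (1 - u) * Re (p\<^sub>1 * cis \<theta>) + u * Re (p\<^sub>2 * cis \<theta>)"
      unfolding \<omega> distrib_right mult_scaleR_left plus_complex.sel scaleR_complex.sel ..
    then show ?thesis unfolding p12 by (simp only: distrib_right[symmetric]) simp
  qed
  then have SH: "?S \<subseteq> H" using q by (auto simp: H_def)
  have contG: "continuous_on ?S G"
    using G SH by (auto simp: H_def intro: holomorphic_on_imp_continuous_on holomorphic_on_subset)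
  obtain B where B: "0 < B" "\<And>\<omega>. \<omega> \<in> ?S \<Longrightarrow> norm (G \<omega>) \<le> B"
    using compact_imp_bounded[OF compact_continuous_image[OF contG compact_segment]]
    unfolding bounded_pos by auto
  define J where "J = (LBINT t:{0<..}. exp (- 1 * t) :: real)"
  have J: "0 \<le> J"
    unfolding J_def set_lebesgue_integral_def by (intro integral_nonneg_AE) auto
  define M where "M = C / sin \<beta> * J + C / sin \<beta> * J + 2 * pi * (B * norm (p\<^sub>2 - p\<^sub>1))"
  have M: "0 \<le> M" using C sin J B by (simp add: M_def)
  have main: "norm (f (of_real s * cis \<theta>)) \<le> (M / (2 * pi)) * exp (- q * s)" if s: "1 \<le> s" for s
  proof -
    define z where "z = of_real s * cis \<theta>"
    \<comment> \<open>Since \<open>s \<ge> 1\<close>, the distance from \<open>z\<close> to both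
      rays has a lower bound independent of \<open>s\<close>.\<close>
    have dist: "sin \<beta> \<le> norm (of_real t * cis (\<theta> - \<beta>) - z)" "sin \<beta> \<le> norm (of_real t * cis (\<theta> + \<beta>) - z)" for t
    proof -
      have "1 * sin \<beta> \<le> s * sin \<beta>" using s sin by (intro mult_right_mono) auto
      then have le: "sin \<beta> \<le> s * sin \<beta>" by (simp only: mult_1)
      show "sin \<beta> \<le> norm (of_real t * cis (\<theta> - \<beta>) - z)" "sin \<beta> \<le> norm (of_real t * cis (\<theta> + \<beta>) - z)"
        using norm_diff_rays_ge[of s "\<theta> - \<beta>" \<theta> t] norm_diff_rays_ge[of s "\<theta> + \<beta>" \<theta> t] sin
        by (auto simp: z_def intro: order_trans[OF le])
    qed
    have Rez: "Re (\<omega> * z) = q * s" if "Re (\<omega> * cis \<theta>) = q" for \<omega>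
    proof -
      have "\<omega> * z = s *\<^sub>R (\<omega> * cis \<theta>)" by (simp add: z_def scaleR_conv_of_real)
      then show ?thesis using that by (simp only: scaleR_complex.sel mult.commute)
    qed
    have hol: "(\<lambda>p. G p * exp (- p * z)) holomorphic_on H"
      using G unfolding H_def by (intro holomorphic_intros)
    obtain P where P: "\<And>p. p \<in> H \<Longrightarrow> (P has_field_derivative G p * exp (- p * z)) (at p)"
      using holomorphic_convex_primitive'[OF H(2,1) hol] at_within_open[OF _ H(1)] by metis
    have B0: "p \<in> H \<and> deep p \<and> G p = ray_laplace \<phi> p / (2 * of_real pi * \<i>)"
      if "p \<in> ball p\<^sub>0 1" "\<bar>\<phi>\<bar> < \<alpha>" for p \<phi>
    proof -
      have d: "deep p" using R(2) that(1) by (simp add: p\<^sub>0_def)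
      then show ?thesis
        using BH[OF that(1)] eq concat_laplace_deep[OF d that(2)] by (simp add: H_def)
    qed
    have "p\<^sub>1 \<in> H" "p\<^sub>2 \<in> H" using SH by auto
    with p1 p2 have "ray_cauchy z (\<theta> - \<beta>) p\<^sub>1 - 2 * of_real pi * \<i> * P p\<^sub>1
          = ray_cauchy z (\<theta> - \<beta>) p\<^sub>0 - 2 * of_real pi * \<i> * P p\<^sub>0"
        "ray_cauchy z (\<theta> + \<beta>) p\<^sub>2 - 2 * of_real pi * \<i> * P p\<^sub>2
          = ray_cauchy z (\<theta> + \<beta>) p\<^sub>0 - 2 * of_real pi * \<i> * P p\<^sub>0"
      by (intro ray_cauchy_minus_primitive_constant[OF _ sin dist(1) H P B0] \<phi>
          ray_cauchy_minus_primitive_constant[OF _ sin dist(2) H P B0]; simp)+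
    moreover have "ray_cauchy z (\<theta> - \<beta>) p\<^sub>0 - ray_cauchy z (\<theta> + \<beta>) p\<^sub>0 = 2 * of_real pi * \<i> * f z"
      using B0[of p\<^sub>0 0] \<alpha> s by (intro ray_cauchy_deep[OF _ \<beta> z_def]) auto
    ultimately have "2 * of_real pi * \<i> * f z = ray_cauchy z (\<theta> - \<beta>) p\<^sub>1 - ray_cauchy z (\<theta> + \<beta>) p\<^sub>2
        + 2 * of_real pi * \<i> * (P p\<^sub>2 - P p\<^sub>1)"
      by algebra
    then have "norm (2 * of_real pi * \<i> * f z) \<le> norm (ray_cauchy z (\<theta> - \<beta>) p\<^sub>1)
        + norm (ray_cauchy z (\<theta> + \<beta>) p\<^sub>2) + norm (2 * of_real pi * \<i> * (P p\<^sub>2 - P p\<^sub>1))"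
      by (simp only: order_trans[OF norm_triangle_ineq add_right_mono[OF norm_triangle_ineq4]])
    also have "\<dots> \<le> C / sin \<beta> * exp (- (q * s)) * J + C / sin \<beta> * exp (- (q * s)) * J
        + 2 * pi * (B * exp (- (q * s)) * norm (p\<^sub>2 - p\<^sub>1))"
    proof (intro add_mono)
      show "norm (ray_cauchy z (\<theta> - \<beta>) p\<^sub>1) \<le> C / sin \<beta> * exp (- (q * s)) * J"
        using ray_cauchy_bound[OF \<phi>(1) p1 sin dist(1)] unfolding J_def Rez[OF p12(1)] .
      show "norm (ray_cauchy z (\<theta> + \<beta>) p\<^sub>2) \<le> C / sin \<beta> * exp (- (q * s)) * J"
        using ray_cauchy_bound[OF \<phi>(2) p2 sin dist(2)] unfolding J_def Rez[OF p12(2)] .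
      have "norm (P p\<^sub>2 - P p\<^sub>1) \<le> B * exp (- (q * s)) * norm (p\<^sub>2 - p\<^sub>1)"
      proof (rule field_differentiable_bound)
        show "convex ?S" by simp
        show "(P has_field_derivative G \<omega> * exp (- \<omega> * z)) (at \<omega> within ?S)" if "\<omega> \<in> ?S" for \<omega>
          using P SH that by (blast intro: has_field_derivative_at_within)
        show "norm (G \<omega> * exp (- \<omega> * z)) \<le> B * exp (- (q * s))" if "\<omega> \<in> ?S" for \<omega>
        proof -
          have "norm (exp (- \<omega> * z)) = exp (- Re (\<omega> * z))" by simp
          then show ?thesis
            unfolding norm_mult Rez[OF seg[OF that]] using B(2)[OF that] by (simp add: mult_right_mono)
        qed
      qed auto
      then show "norm (2 * of_real pi * \<i> * (P p\<^sub>2 - P p\<^sub>1)) \<le> 2 * pi * (B * exp (- (q * s)) * norm (p\<^sub>2 - p\<^sub>1))"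
        by (simp add: norm_mult)
    qed
    also have "\<dots> = M * exp (- (q * s))"
      by (simp add: M_def algebra_simps)
    finally have "2 * pi * norm (f z) \<le> M * exp (- (q * s))"
      by (simp add: norm_mult)
    then show ?thesis by (simp add: z_def field_simps)
  qed
  show thesis
  proof
    \<comment> \<open>The added 1 makes the constant positive, as its logarithm is taken
      later.\<close>
    show "0 < M / (2 * pi) + 1" using M by (simp add: add_nonneg_pos)
    show "norm (f (of_real s * cis \<theta>)) \<le> (M / (2 * pi) + 1) * exp (- q * s)" if "1 \<le> s" for s
      using main[OF that] by (rule order_trans) (simp add: distrib_right)
  qed
qed

end

section \<open>Contradiction with the indicator\<close>

theorem theorem1p5:
  fixes \<alpha> h \<theta> :: real and f :: "complex \<Rightarrow> complex" and \<Omega>' :: "complex set"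
  assumes "0 < \<alpha>" and "\<alpha> < pi / 2"
    and "0 \<le> h"
    and "f analytic_on sector \<alpha>"
    and "exp_type_at_most h f (sector \<alpha>)"
    and "\<bar>\<theta>\<bar> < \<alpha>"
    and "open_half_plane \<Omega>'"
    and "laplace_half_plane \<alpha> f \<theta> \<subset> \<Omega>'"
  shows "\<not> (\<exists>G. analytic_continuation (concat_laplace \<alpha> f) (laplace_domain \<alpha> f) G \<Omega>')"
proof
  assume "\<exists>G. analytic_continuation (concat_laplace \<alpha> f) (laplace_domain \<alpha> f) G \<Omega>'"
  then obtain G where G: "G holomorphic_on \<Omega>'"
      "\<And>\<omega>. \<omega> \<in> laplace_domain \<alpha> f \<Longrightarrow> \<omega> \<in> \<Omega>' \<Longrightarrow> G \<omega> = concat_laplace \<alpha> f \<omega>"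
    unfolding analytic_continuation_def by blast
  obtain C where C: "0 \<le> C" "\<And>z. z \<in> sector \<alpha> \<Longrightarrow> norm (f z) \<le> C * exp ((h + 1) * norm z)"
    using assms(5) unfolding exp_type_at_most_def by (meson zero_less_one)
  \<comment> \<open>The type hypothesis is used with \<open>\<epsilon> = 1\<close>;
    \<open>C + 1\<close> is positive.\<close>
  interpret sector_function \<alpha> "h + 1" "C + 1" f
  proof
    show "norm (f z) \<le> (C + 1) * exp ((h + 1) * norm z)" if "z \<in> sector \<alpha>" for z
      using C(2)[OF that] by (rule order_trans) (simp add: distrib_right)
  qed (use assms C(1) in \<open>auto intro: analytic_imp_holomorphic\<close>)
  obtain u c where u: "u \<noteq> 0" and \<Omega>': "\<Omega>' = {\<omega>. u \<bullet> \<omega> < c}"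
    using assms(7) unfolding open_half_plane_def by blast
  \<comment> \<open>The exponential bound excludes the value infinity; at minus infinity the
    half-plane is the whole plane and has no proper superset.\<close>
  obtain I where I: "growth_indicator \<alpha> f \<theta> = ereal I"
  proof (cases "growth_indicator \<alpha> f \<theta>")
    case PInf
    then show ?thesis using growth_indicator_le_type[OF assms(6)] by simp
  next
    case MInf
    then have "laplace_half_plane \<alpha> f \<theta> = UNIV" by (simp add: laplace_half_plane_def)
    then show ?thesis using assms(8) by auto
  qed
  have half_plane: "laplace_half_plane \<alpha> f \<theta> = {\<omega>. Re (\<omega> * cis \<theta>) < - I}"
    unfolding laplace_half_plane_def I by (simp only: uminus_ereal.simps less_ereal.simps)
  obtain b where b: "- I < b" "{\<omega>. Re (\<omega> * cis \<theta>) < b} \<subseteq> \<Omega>'"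
    using half_plane_psubset[OF u, of \<theta> "- I" c] assms(8) unfolding half_plane \<Omega>' by blast
  \<comment> \<open>The midpoint of \<open>- I\<close> and \<open>b\<close>.\<close>
  define q where "q = (b - I) / 2"
  have q: "- I < q" "q < b" using b(1) by (auto simp: q_def)
  have "G holomorphic_on {\<omega>. Re (\<omega> * cis \<theta>) < b}"
    using G(1) b(2) by (rule holomorphic_on_subset)
  moreover have "G \<omega> = concat_laplace \<alpha> f \<omega>" if "\<omega> \<in> laplace_domain \<alpha> f" "Re (\<omega> * cis \<theta>) < b" for \<omega>
    using G(2) b(2) that by blast
  ultimately obtain M where "0 < M" "\<And>s. 1 \<le> s \<Longrightarrow> norm (f (of_real s * cis \<theta>)) \<le> M * exp (- q * s)"
    using continuation_decay[OF assms(6) _ _ q(2)] by metis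
  then have "growth_indicator \<alpha> f \<theta> \<le> ereal (- q)"
    using assms(2,6) by (intro growth_indicator_le)
  then show False using q(1) by (simp add: I)
qed

end
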